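(* (1) For all $k,n\ge0$ there exist differential polynomials $\Phi_k^n$ (in $u$, the $\sigma_j$ and their $x$-derivatives) such that \[\frac{\partial R_{k+1}}{\partial\tau_n}=(\Phi_k^n)'.\] (2) The equations \[\frac{\partial f_k}{\partial t_n}=\Omega_{k,n},\qquad \frac{\partial f_k}{\partial\tau_n}=\Phi_k^n,\qquad k,n\ge0,\] together with the flows \[\frac{\partial u}{\partial t_n}=R_{n+1}',\quad \frac{\partial u}{\partial\tau_n}=\sigma_n',\quad \frac{\partial\sigma_k}{\partial t_n}=\frac12\sum_{i=0}^n\frac{\Gamma(n+\frac12-i)}{\Gamma(n+\frac32)}\big(R_{n-i}\sigma_{k+i}'-R_{n-i}'\sigma_{k+i}\big),\] \[\frac{\partial\sigma_k}{\partial\tau_n}=-\frac{\partial\sigma_n}{\partial\tau_k}=\frac12\sum_{i=0}^{n-k-1}\sigma_{i+k}\sigma_{n-i-1}'\quad(0\le k\le n),\] give the super tau-cover of the KdV hierarchy; that is, all the flows $\partial/\partial t_n$, $\partial/\partial\tau_n$ on the unknowns $f_k,u,\sigma_k$ mutually commute in the graded sense (odd flows anticommute with each other, all other pairs commute).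
   Context: Fix a parameter $\varepsilon$. Prime denotes $\partial_x$. Let $\mathcal P_0=\partial_x$, $\mathcal P_1=u\partial_x+\frac12u'+\frac{\varepsilon^2}8\partial_x^3$. Differential polynomials $R_n$ in $u$ are defined by $R_0=1$, $(n+\frac12)\mathcal P_0R_{n+1}=\mathcal P_1R_n$, with integration constant of $R_n$ ($n\ge1$) equal to zero. The KdV hierarchy is $\partial u/\partial t_n=R_{n+1}'$, $n\ge0$ ($t_0=x$). $\Omega_{n,k}$ are the differential polynomials in $u$ with vanishing constant term such that $\Omega_{n,k}'=\partial R_{n+1}/\partial t_k$. The $f_k$ (one-point functions) are additional even unknowns with $f_k'=R_{k+1}$. The differential ring is the supercommutative ring generated by $u$ (even), odd variables $\sigma_k$ ($k\ge0$) and all their $x$-derivatives, subject to the relations $\mathcal P_0\sigma_{k+1}=\mathcal P_1\sigma_k$, i.e. $\sigma_{k+1}'=u\sigma_k'+\frac12u'\sigma_k+\frac{\varepsilon^2}8\sigma_k'''$ ($k\ge0$), and their $x$-derivatives, with the convention that there are no nonzero odd constants (elements of positive super degree annihilated by $\partial_x$ vanish). The flows $\partial/\partial t_n$ are even derivations and $\partial/\partial\tau_n$ odd derivations (signed Leibniz rule), commuting with $\partial_x$. An empty sum is $0$. *)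

theory Defs
  imports "HOL-Analysis.Gamma_Function" "HOL-Library.Poly_Mapping"
begin

section \<open>Scalars\<close>

text \<open>The dispersion parameter is a fixed but arbitrary element of an arbitrary commutative real
  algebra of scalars: a real or complex number, or a formal parameter as in C[eps].  It is a
  constant of a type class, and not a variable, because the differential ring below, which depends
  on it, is a type.\<close>

class kdv_scalars = comm_ring_1 + real_algebra_1 +
  fixes dispersion :: 'a  ("\<epsilon>")


section \<open>The free associative algebra on the jet variables\<close>

text \<open>\<open>Ujet s\<close> and \<open>Sjet k s\<close> stand for the \<open>s\<close>-th \<open>x\<close>-derivatives of \<open>u\<close> and of \<open>\<sigma>\<^sub>k\<close>.  The word type
  is a copy of \<open>gen list\<close> on which addition is concatenation, so that \<open>word \<Rightarrow>\<^sub>0 'k\<close> with the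
  convolution product of \<^theory>\<open>HOL-Library.Poly_Mapping\<close> is the free associative algebra.\<close>

datatype gen = Ujet nat | Sjet nat nat

datatype word = Word (letters: "gen list")

instantiation word :: monoid_add
begin
definition zero_word :: word where "0 = Word []"
definition plus_word :: "word \<Rightarrow> word \<Rightarrow> word" where "v + w = Word (letters v @ letters w)"
instance by standard (simp_all add: zero_word_def plus_word_def)
end

type_synonym 'k freealg = "word \<Rightarrow>\<^sub>0 'k"

definition fgen :: "gen \<Rightarrow> 'k::kdv_scalars freealg" where
  "fgen g = Poly_Mapping.single (Word [g]) 1"

definition fscal :: "'k::kdv_scalars \<Rightarrow> 'k freealg" where
  "fscal c = Poly_Mapping.single 0 c"

fun next_gen :: "gen \<Rightarrow> gen" where
  "next_gen (Ujet s) = Ujet (Suc s)"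
| "next_gen (Sjet k s) = Sjet k (Suc s)"

definition fdx_word :: "word \<Rightarrow> 'k::kdv_scalars freealg" where
  "fdx_word w = (\<Sum>i<length (letters w).
     Poly_Mapping.single (Word ((letters w)[i := next_gen (letters w ! i)])) 1)"

definition fdx :: "'k::kdv_scalars freealg \<Rightarrow> 'k freealg" where
  "fdx a = (\<Sum>w\<in>Poly_Mapping.keys a. fscal (Poly_Mapping.lookup a w) * fdx_word w)"

definition fP1 :: "'k::kdv_scalars freealg \<Rightarrow> 'k freealg" where
  "fP1 a = fgen (Ujet 0) * fdx a + fscal (of_real (1/2)) * (fgen (Ujet 1) * a)
           + fscal (of_real (1/8) * \<epsilon>\<^sup>2) * fdx (fdx (fdx a))"

fun is_odd_gen :: "gen \<Rightarrow> bool" where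
  "is_odd_gen (Ujet s) = False"
| "is_odd_gen (Sjet k s) = True"

definition super_degree :: "word \<Rightarrow> nat" where
  "super_degree w = length (filter is_odd_gen (letters w))"


section \<open>The differential ring\<close>

text \<open>The ideal of relations is the least two-sided differential ideal that contains the graded
  commutators of the generators and the relations between the \<open>\<sigma>\<^sub>k\<close>, and that satisfies the
  convention on odd constants (last rule).  The rule \<open>scomm\<close> for an odd generator taken twice
  says that its square vanishes, since 2 is invertible.\<close>

inductive_set rel_ideal :: "'k::kdv_scalars freealg set" where
  zero: "0 \<in> rel_ideal"
| add: "a \<in> rel_ideal \<Longrightarrow> b \<in> rel_ideal \<Longrightarrow> a + b \<in> rel_ideal"
| mult: "a \<in> rel_ideal \<Longrightarrow> b * a * c \<in> rel_ideal"
| dx: "a \<in> rel_ideal \<Longrightarrow> fdx a \<in> rel_ideal"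
| scomm: "fgen g * fgen h
            - (if is_odd_gen g \<and> is_odd_gen h then -1 else 1) * (fgen h * fgen g) \<in> rel_ideal"
| sigma: "fdx (fgen (Sjet (Suc k) 0)) - fP1 (fgen (Sjet k 0)) \<in> rel_ideal"
| odd_const: "(\<And>w. w \<in> Poly_Mapping.keys a \<Longrightarrow> 0 < super_degree w) \<Longrightarrow> fdx a \<in> rel_ideal
            \<Longrightarrow> a \<in> rel_ideal"

lemma rel_ideal_uminus: "a \<in> rel_ideal \<Longrightarrow> - a \<in> rel_ideal"
  using rel_ideal.mult[of a "-1" 1] by simp

lemma rel_ideal_diff: "a \<in> rel_ideal \<Longrightarrow> b \<in> rel_ideal \<Longrightarrow> a - b \<in> rel_ideal"
  using rel_ideal.add[OF _ rel_ideal_uminus, of a b] by simp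

lemma rel_ideal_mult_left: "a \<in> rel_ideal \<Longrightarrow> b * a \<in> rel_ideal"
  using rel_ideal.mult[of a b 1] by simp

lemma rel_ideal_mult_right: "a \<in> rel_ideal \<Longrightarrow> a * c \<in> rel_ideal"
  using rel_ideal.mult[of a 1 c] by simp

lemma fdx_superset:
  assumes "finite W" "Poly_Mapping.keys a \<subseteq> W"
  shows "fdx a = (\<Sum>w\<in>W. fscal (Poly_Mapping.lookup a w) * fdx_word w)"
  unfolding fdx_def using assms
  by (intro sum.mono_neutral_left) (auto simp: in_keys_iff fscal_def)

lemma fdx_add: "fdx (a + b) = fdx a + fdx b"
proof -
  let ?W = "Poly_Mapping.keys a \<union> Poly_Mapping.keys b"
  have "Poly_Mapping.keys (a + b) \<subseteq> ?W" by (rule keys_add)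
  then show ?thesis
    by (simp add: fdx_superset[where W = ?W] lookup_add fscal_def single_add
        distrib_right sum.distrib)
qed

lemma fdx_uminus: "fdx (- a) = - fdx a"
  using fdx_add[of a "- a"] by (simp add: fdx_def[of 0] eq_neg_iff_add_eq_0 add.commute)

lemma fdx_diff: "fdx (a - b) = fdx a - fdx b"
  using fdx_add[of a "- b"] by (simp add: fdx_uminus)

text \<open>The ideal is proper: no element has a constant term.\<close>

lemma lookup_mult_zero_word:
  fixes a b :: "'k::kdv_scalars freealg"
  shows "Poly_Mapping.lookup (a * b) 0 = Poly_Mapping.lookup a 0 * Poly_Mapping.lookup b 0"
proof -
  have *: "0 = v + w \<longleftrightarrow> v = 0 \<and> w = 0" for v w :: word
    by (cases v; cases w) (auto simp: zero_word_def plus_word_def)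
  have "(Poly_Mapping.lookup b q when 0 = v + q) = (Poly_Mapping.lookup b q when v = 0 when q = 0)"
    for v q by (auto simp: * when_def)
  then have "(\<Sum>q. Poly_Mapping.lookup b q when 0 = v + q) = (Poly_Mapping.lookup b 0 when v = 0)"
    for v by simp
  then show ?thesis
    by (simp add: lookup_mult mult_when)
qed

lemma lookup_fdx_zero: "Poly_Mapping.lookup (fdx (a :: 'a::kdv_scalars freealg)) 0 = 0"
proof -
  have "Poly_Mapping.lookup (fdx_word w :: 'a freealg) 0 = 0" for w
    unfolding fdx_word_def lookup_sum
    by (intro sum.neutral) (auto simp: lookup_single zero_word_def when_def)
  then show ?thesis
    by (simp add: fdx_def lookup_sum lookup_mult_zero_word)
qed

lemma lookup_fgen_zero: "Poly_Mapping.lookup (fgen g) 0 = 0"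
  by (simp add: fgen_def lookup_single zero_word_def)

lemma rel_ideal_no_constant:
  assumes "a \<in> rel_ideal"
  shows "Poly_Mapping.lookup a 0 = 0"
  using assms
proof induction
  case (odd_const a)
  have "0 \<notin> Poly_Mapping.keys a"
    using odd_const(1)[of 0] by (auto simp: super_degree_def zero_word_def)
  then show ?case
    by (simp add: in_keys_iff)
next
  case (scomm g h)
  then show ?case
    by (simp only: lookup_minus lookup_mult_zero_word lookup_fgen_zero mult_zero_right diff_zero)
next
  case (sigma k)
  then show ?case
    by (simp only: fP1_def lookup_add lookup_minus lookup_mult_zero_word lookup_fdx_zero
        lookup_fgen_zero mult_zero_right mult_zero_left add_0 diff_zero)
qed (simp_all only: lookup_zero lookup_add lookup_mult_zero_word lookup_fdx_zero mult_zero_left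
      mult_zero_right add_0)

definition rel_cong :: "'k::kdv_scalars freealg \<Rightarrow> 'k freealg \<Rightarrow> bool" where
  "rel_cong a b \<longleftrightarrow> a - b \<in> rel_ideal"

lemma equivp_rel_cong: "equivp (rel_cong :: 'a::kdv_scalars freealg \<Rightarrow> _)"
proof (rule equivpI)
  show "reflp (rel_cong :: 'a freealg \<Rightarrow> _)"
    by (simp add: reflp_def rel_cong_def rel_ideal.zero)
  show "symp (rel_cong :: 'a freealg \<Rightarrow> _)"
    by (metis minus_diff_eq rel_cong_def rel_ideal_uminus sympI)
  show "transp (rel_cong :: 'a freealg \<Rightarrow> _)"
  proof (rule transpI)
    fix a b c :: "'a freealg"
    assume "rel_cong a b" "rel_cong b c"
    moreover have "a - c = (a - b) + (b - c)" by simp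
    ultimately show "rel_cong a c" by (simp only: rel_cong_def rel_ideal.add)
  qed
qed

quotient_type (overloaded) 'k sdiff = "'k::kdv_scalars freealg" / rel_cong
  by (rule equivp_rel_cong)

instantiation sdiff :: (kdv_scalars) ring_1
begin

lift_definition zero_sdiff :: "'a sdiff" is 0 .
lift_definition one_sdiff :: "'a sdiff" is 1 .
lift_definition plus_sdiff :: "'a sdiff \<Rightarrow> 'a sdiff \<Rightarrow> 'a sdiff" is "(+)"
  unfolding rel_cong_def by (metis add_diff_add rel_ideal.add)
lift_definition uminus_sdiff :: "'a sdiff \<Rightarrow> 'a sdiff" is uminus
  unfolding rel_cong_def by (metis minus_diff_minus rel_ideal_uminus)
lift_definition minus_sdiff :: "'a sdiff \<Rightarrow> 'a sdiff \<Rightarrow> 'a sdiff" is "(-)"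
proof -
  fix a a' b b' :: "'a freealg"
  assume "rel_cong a a'" "rel_cong b b'"
  moreover have "a - b - (a' - b') = (a - a') - (b - b')"
    by simp
  ultimately show "rel_cong (a - b) (a' - b')"
    by (simp only: rel_cong_def rel_ideal_diff)
qed
lift_definition times_sdiff :: "'a sdiff \<Rightarrow> 'a sdiff \<Rightarrow> 'a sdiff" is "(*)"
proof -
  fix a a' b b' :: "'a freealg"
  assume "rel_cong a a'" "rel_cong b b'"
  moreover have "a * b - a' * b' = (a - a') * b + a' * (b - b')"
    by (simp add: algebra_simps)
  ultimately show "rel_cong (a * b) (a' * b')"
    by (simp add: rel_cong_def rel_ideal.add rel_ideal_mult_left rel_ideal_mult_right)
qed

instance
proof
  show "(0 :: 'a sdiff) \<noteq> 1"
    by transfer (use rel_ideal_no_constant in \<open>fastforce simp: rel_cong_def lookup_minus lookup_one\<close>)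
qed (transfer; simp add: rel_cong_def algebra_simps rel_ideal.zero)+

end

lift_definition scal :: "'k::kdv_scalars \<Rightarrow> 'k sdiff" is fscal .

lift_definition u_var :: "'k::kdv_scalars sdiff" is "fgen (Ujet 0)" .

lift_definition \<sigma> :: "nat \<Rightarrow> 'k::kdv_scalars sdiff" is "\<lambda>k. fgen (Sjet k 0)" .

lift_definition dx :: "'k::kdv_scalars sdiff \<Rightarrow> 'k sdiff" is fdx
  unfolding rel_cong_def by (metis fdx_diff rel_ideal.dx)

text \<open>The argument of \<open>parity\<close> says whether the elements are odd.\<close>

definition parity :: "bool \<Rightarrow> 'k::kdv_scalars sdiff set" where
  "parity q = abs_sdiff ` {a. \<forall>w\<in>Poly_Mapping.keys a. odd (super_degree w) = q}"

text \<open>The differential polynomials in \<open>u\<close> alone, without constant term.\<close>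

definition upolys0 :: "'k::kdv_scalars sdiff set" where
  "upolys0 = abs_sdiff ` {a. \<forall>w\<in>Poly_Mapping.keys a. super_degree w = 0 \<and> w \<noteq> 0}"

definition P1 :: "'k::kdv_scalars sdiff \<Rightarrow> 'k sdiff" where
  "P1 a = u_var * dx a + scal (of_real (1/2)) * (dx u_var * a)
          + scal (of_real (1/8) * \<epsilon>\<^sup>2) * dx (dx (dx a))"

lemma fdx_fgen: "fdx (fgen g) = fgen (next_gen g)"
  by (simp add: fdx_def fgen_def fscal_def fdx_word_def mult_single)

lemma dx_sigma_Suc: "dx (\<sigma> (Suc k)) = P1 (\<sigma> k)"
  unfolding P1_def
  by transfer (use rel_ideal.sigma in \<open>simp add: rel_cong_def fP1_def fdx_fgen\<close>)


section \<open>The KdV hierarchy and its super extension\<close>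

text \<open>\<open>R\<close> is the sequence of the \<open>R\<^sub>n\<close>; it is determined uniquely.\<close>

definition lenard :: "(nat \<Rightarrow> 'k::kdv_scalars sdiff) \<Rightarrow> bool" where
  "lenard R \<longleftrightarrow> R 0 = 1 \<and>
     (\<forall>n. R (Suc n) \<in> upolys0 \<and> scal (of_real (real n + 1/2)) * dx (R (Suc n)) = P1 (R n))"

text \<open>\<open>super_derivation par sc q D\<close>: \<open>D\<close> is a derivation of parity \<open>q\<close> over the scalars \<open>sc\<close>, on a
  ring with even part \<open>par False\<close> and odd part \<open>par True\<close>.\<close>

definition super_derivation ::
  "(bool \<Rightarrow> 'a::ring_1 set) \<Rightarrow> ('k \<Rightarrow> 'a) \<Rightarrow> bool \<Rightarrow> ('a \<Rightarrow> 'a) \<Rightarrow> bool" where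
  "super_derivation par sc q D \<longleftrightarrow>
     (\<forall>a b. D (a + b) = D a + D b) \<and>
     (\<forall>c. D (sc c) = 0) \<and>
     (\<forall>p. \<forall>a\<in>par p. D a \<in> par (p \<noteq> q)) \<and>
     (\<forall>p. \<forall>a\<in>par p. \<forall>b. D (a * b) = D a * b + (if p \<and> q then -1 else 1) * a * D b)"

definition t_sigma :: "(nat \<Rightarrow> 'k::kdv_scalars sdiff) \<Rightarrow> nat \<Rightarrow> nat \<Rightarrow> 'k sdiff" where
  "t_sigma R n k = scal (of_real (1/2)) *
     (\<Sum>i=0..n. scal (of_real (Gamma (real n + 1/2 - real i) / Gamma (real n + 3/2))) *
        (R (n - i) * dx (\<sigma> (k + i)) - dx (R (n - i)) * \<sigma> (k + i)))"

text \<open>Only used for \<open>k \<le> n\<close>; then no subtraction is truncated.\<close>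

definition tau_sigma :: "nat \<Rightarrow> nat \<Rightarrow> 'k::kdv_scalars sdiff" where
  "tau_sigma n k = scal (of_real (1/2)) * (\<Sum>i<n - k. \<sigma> (i + k) * dx (\<sigma> (n - i - 1)))"

text \<open>\<open>t n\<close> and \<open>\<tau> n\<close> are the flows along the even time \<open>t\<^sub>n\<close> and the odd time \<open>\<tau>\<^sub>n\<close>.\<close>

definition super_kdv_flows ::
  "(nat \<Rightarrow> 'k::kdv_scalars sdiff) \<Rightarrow> (nat \<Rightarrow> 'k sdiff \<Rightarrow> 'k sdiff) \<Rightarrow>
     (nat \<Rightarrow> 'k sdiff \<Rightarrow> 'k sdiff) \<Rightarrow> bool" where
  "super_kdv_flows R t \<tau> \<longleftrightarrow>
     (\<forall>n. super_derivation parity scal False (t n) \<and> (\<forall>a. t n (dx a) = dx (t n a))) \<and>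
     (\<forall>n. super_derivation parity scal True (\<tau> n) \<and> (\<forall>a. \<tau> n (dx a) = dx (\<tau> n a))) \<and>
     (\<forall>n. t n u_var = dx (R (Suc n))) \<and>
     (\<forall>n. \<tau> n u_var = dx (\<sigma> n)) \<and>
     (\<forall>n k. t n (\<sigma> k) = t_sigma R n k) \<and>
     (\<forall>n k. k \<le> n \<longrightarrow> \<tau> n (\<sigma> k) = tau_sigma n k \<and> \<tau> k (\<sigma> n) = - tau_sigma n k)"

definition two_point :: "(nat \<Rightarrow> 'k::kdv_scalars sdiff) \<Rightarrow> (nat \<Rightarrow> 'k sdiff \<Rightarrow> 'k sdiff) \<Rightarrow>
     (nat \<Rightarrow> nat \<Rightarrow> 'k sdiff) \<Rightarrow> bool" where
  "two_point R t \<Omega> \<longleftrightarrow> (\<forall>n k. \<Omega> n k \<in> upolys0 \<and> dx (\<Omega> n k) = t k (R (Suc n)))"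

text \<open>\<open>super_two_point R \<tau> k n \<phi>\<close>: \<open>\<phi>\<close> can serve as \<open>\<Phi>\<^sub>k\<^sup>n\<close>.  It has to be odd, because it is the
  value of an odd flow on an even unknown; only an additive constant is excluded by this.\<close>

definition super_two_point :: "(nat \<Rightarrow> 'k::kdv_scalars sdiff) \<Rightarrow> (nat \<Rightarrow> 'k sdiff \<Rightarrow> 'k sdiff) \<Rightarrow>
     nat \<Rightarrow> nat \<Rightarrow> 'k sdiff \<Rightarrow> bool" where
  "super_two_point R \<tau> k n \<phi> \<longleftrightarrow> \<phi> \<in> parity True \<and> \<tau> n (R (Suc k)) = dx \<phi>"


section \<open>Adjoining the one-point functions\<close>

text \<open>Polynomials in the even, hence central, unknowns \<open>f\<^sub>k\<close> over the differential ring.\<close>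

type_synonym 'k tau_ring = "(nat \<Rightarrow>\<^sub>0 nat) \<Rightarrow>\<^sub>0 'k sdiff"

definition emb :: "'k::kdv_scalars sdiff \<Rightarrow> 'k tau_ring" where
  "emb a = Poly_Mapping.single 0 a"

definition f_var :: "nat \<Rightarrow> 'k::kdv_scalars tau_ring" where
  "f_var k = Poly_Mapping.single (Poly_Mapping.single k 1) 1"

definition tau_parity :: "bool \<Rightarrow> 'k::kdv_scalars tau_ring set" where
  "tau_parity q = {p. \<forall>m. Poly_Mapping.lookup p m \<in> parity q}"

definition tau_scal :: "'k::kdv_scalars \<Rightarrow> 'k tau_ring" where
  "tau_scal c = emb (scal c)"

text \<open>\<open>X\<close>, \<open>T n\<close> and \<open>\<Theta> n\<close> are the extensions of \<open>dx\<close>, \<open>t n\<close> and \<open>\<tau> n\<close> to the enlarged ring.\<close>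

definition super_tau_cover ::
  "(nat \<Rightarrow> 'k::kdv_scalars sdiff) \<Rightarrow> (nat \<Rightarrow> 'k sdiff \<Rightarrow> 'k sdiff) \<Rightarrow>
     (nat \<Rightarrow> 'k sdiff \<Rightarrow> 'k sdiff) \<Rightarrow> (nat \<Rightarrow> nat \<Rightarrow> 'k sdiff) \<Rightarrow> (nat \<Rightarrow> nat \<Rightarrow> 'k sdiff) \<Rightarrow>
     ('k tau_ring \<Rightarrow> 'k tau_ring) \<Rightarrow> (nat \<Rightarrow> 'k tau_ring \<Rightarrow> 'k tau_ring) \<Rightarrow>
     (nat \<Rightarrow> 'k tau_ring \<Rightarrow> 'k tau_ring) \<Rightarrow> bool" where
  "super_tau_cover R t \<tau> \<Omega> \<Phi> X T \<Theta> \<longleftrightarrow>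
     super_derivation tau_parity tau_scal False X \<and>
     (\<forall>a. X (emb a) = emb (dx a)) \<and> (\<forall>k. X (f_var k) = emb (R (Suc k))) \<and>
     (\<forall>n. super_derivation tau_parity tau_scal False (T n) \<and> (\<forall>p. T n (X p) = X (T n p)) \<and>
        (\<forall>a. T n (emb a) = emb (t n a)) \<and> (\<forall>k. T n (f_var k) = emb (\<Omega> k n))) \<and>
     (\<forall>n. super_derivation tau_parity tau_scal True (\<Theta> n) \<and> (\<forall>p. \<Theta> n (X p) = X (\<Theta> n p)) \<and>
        (\<forall>a. \<Theta> n (emb a) = emb (\<tau> n a)) \<and> (\<forall>k. \<Theta> n (f_var k) = emb (\<Phi> k n)))"

definition mutually_commute :: "(nat \<Rightarrow> 'a::ring_1 \<Rightarrow> 'a) \<Rightarrow> (nat \<Rightarrow> 'a \<Rightarrow> 'a) \<Rightarrow> bool" where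
  "mutually_commute T \<Theta> \<longleftrightarrow>
     (\<forall>m n p. T m (T n p) = T n (T m p)) \<and>
     (\<forall>m n p. T m (\<Theta> n p) = \<Theta> n (T m p)) \<and>
     (\<forall>m n p. \<Theta> m (\<Theta> n p) = - \<Theta> n (\<Theta> m p))"

end

theory Submission
  imports Defs
begin

text \<open>After rescaling, the hierarchy reads \<open>r\<^sub>0 = 1\<close>, \<open>r\<^sub>n\<^sub>+\<^sub>1' = \<P>\<^sub>1 r\<^sub>n\<close>, with bracket
  \<open>{a, b} = a b' - a' b\<close>.  The values of the flows on the \<open>\<sigma>\<^sub>k\<close> satisfy
  \<open>W\<^sub>n\<^sub>+\<^sub>1\<^sub>,\<^sub>k = W\<^sub>n\<^sub>,\<^sub>k\<^sub>+\<^sub>1 + {r\<^sub>n\<^sub>+\<^sub>1, \<sigma>\<^sub>k}\<close> and \<open>Z\<^sub>n\<^sub>+\<^sub>1\<^sub>,\<^sub>k = Z\<^sub>n\<^sub>,\<^sub>k\<^sub>+\<^sub>1 + {\<sigma>\<^sub>n, \<sigma>\<^sub>k}\<close>, with \<open>Z\<close>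
  antisymmetric, and one identity between \<open>\<P>\<^sub>1\<close> and the bracket shows that they are compatible with
  the relations of the ring, so that the flows exist.

  The only constants of the differential ring are the scalars, so two elements with the same
  derivative and the same constant term are equal.  Hence \<open>\<partial>r\<^sub>m\<^sub>+\<^sub>1/\<partial>\<tau>\<^sub>n = \<partial>\<sigma>\<^sub>n/\<partial>t\<^sub>m\<close> (up to
  normalisation), and this is an \<open>x\<close>-derivative since \<open>\<P>\<^sub>1\<close> is skew-adjoint.  A commutator \<open>K\<close> of
  two flows that kills \<open>u\<close> satisfies \<open>(K \<sigma>\<^sub>k\<^sub>+\<^sub>1)' = \<P>\<^sub>1 (K \<sigma>\<^sub>k)\<close>; together with the antisymmetry of
  \<open>Z\<close> this recursion forces \<open>K = 0\<close>.  On the \<open>f\<^sub>k\<close> the commutators vanish because their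
  \<open>x\<close>-derivatives do.\<close>


section \<open>Polynomials with central variables and their derivations\<close>

lemma poly_mapping_induct [case_names single add]:
  fixes a :: "'w \<Rightarrow>\<^sub>0 'c::comm_monoid_add"
  assumes single: "\<And>w c. P (Poly_Mapping.single w c)"
    and add: "\<And>a b. P a \<Longrightarrow> P b \<Longrightarrow> P (a + b)"
  shows "P a"
proof (induction a rule: update_induct)
  case const
  show ?case using single[of undefined 0] by simp
next
  case (update f w c)
  have "Poly_Mapping.update w c f = Poly_Mapping.single w c + f"
    using update by (intro poly_mapping_eqI) (auto simp: lookup_update lookup_add lookup_single in_keys_iff when_def)
  then show ?case by (simp add: single add update)
qed

text \<open>An additive rather than a linear extension: \<open>f\<close> receives the coefficient as
  an argument, because coefficients need not commute with the values and because a derivation acts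
  on them too.\<close>

definition linext :: "('w \<Rightarrow> 'c \<Rightarrow> 'b) \<Rightarrow> ('w \<Rightarrow>\<^sub>0 'c::comm_monoid_add) \<Rightarrow> 'b::ab_group_add" where
  "linext f p = (\<Sum>w\<in>Poly_Mapping.keys p. f w (Poly_Mapping.lookup p w))"

lemma linext_add:
  assumes "\<And>w c d. f w (c + d) = f w c + f w d"
  shows "linext f (p + q) = linext f p + linext f q"
proof -
  have f0: "f w 0 = 0" for w using assms[of w 0 0] by simp
  let ?W = "Poly_Mapping.keys p \<union> Poly_Mapping.keys q"
  have *: "linext f r = (\<Sum>w\<in>?W. f w (Poly_Mapping.lookup r w))" if "Poly_Mapping.keys r \<subseteq> ?W" for r
    unfolding linext_def using that by (intro sum.mono_neutral_left) (auto simp: in_keys_iff f0)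
  show ?thesis
    using keys_add[of p q] by (simp add: * lookup_add assms sum.distrib)
qed

lemma linext_single:
  assumes "\<And>w c d. f w (c + d) = f w c + f w d"
  shows "linext f (Poly_Mapping.single w c) = f w c"
  using assms[of w 0 0] by (simp add: linext_def)

lemma additive_zero:
  fixes D :: "'a::monoid_add \<Rightarrow> 'b::group_add"
  assumes "\<And>a b. D (a + b) = D a + D b"
  shows "D 0 = 0"
  by (metis add.right_neutral add_left_cancel assms)

lemma additive_uminus:
  fixes D :: "'a::group_add \<Rightarrow> 'b::group_add"
  assumes "\<And>a b. D (a + b) = D a + D b"
  shows "D (- a) = - D a"
  using assms[of "- a" a] additive_zero[OF assms] by (simp add: eq_neg_iff_add_eq_0)

lemma additive_diff:
  fixes D :: "'a::group_add \<Rightarrow> 'b::group_add"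
  assumes "\<And>a b. D (a + b) = D a + D b"
  shows "D (a - b) = D a - D b"
  using assms[of a "- b"] additive_uminus[OF assms] by simp

lemma lookup_map_zero:
  "f 0 = 0 \<Longrightarrow> Poly_Mapping.lookup (Poly_Mapping.map f p) m = f (Poly_Mapping.lookup p m)"
  by (simp add: Poly_Mapping.map.rep_eq when_def)

lemma poly_map_add:
  assumes "\<And>a b. f (a + b) = f a + f b" "f 0 = 0"
  shows "Poly_Mapping.map f (p + q) = Poly_Mapping.map f p + Poly_Mapping.map f q"
  by (rule poly_mapping_eqI) (simp add: lookup_map_zero lookup_add assms)

lemma single_one_commute:
  fixes p :: "'m::comm_monoid_add \<Rightarrow>\<^sub>0 'a::ring_1"
  shows "Poly_Mapping.single m 1 * p = p * Poly_Mapping.single m 1"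
  by (induction p rule: poly_mapping_induct) (simp_all add: mult_single add.commute algebra_simps)

lemma single_split:
  "Poly_Mapping.single m a = Poly_Mapping.single 0 a * Poly_Mapping.single m (1 :: 'a::semiring_1)"
  by (simp add: mult_single)

lemma poly_var_induct [case_names const var add mult]:
  fixes p :: "(nat \<Rightarrow>\<^sub>0 nat) \<Rightarrow>\<^sub>0 'a::semiring_1"
  assumes const: "\<And>a. P (Poly_Mapping.single 0 a)"
    and var: "\<And>k. P (Poly_Mapping.single (Poly_Mapping.single k 1) 1)"
    and add: "\<And>p q. P p \<Longrightarrow> P q \<Longrightarrow> P (p + q)"
    and mult: "\<And>p q. P p \<Longrightarrow> P q \<Longrightarrow> P (p * q)"
  shows "P p"
proof (induction p rule: poly_mapping_induct)
  case (single m a)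
  have "P (Poly_Mapping.single m 1)"
  proof (induction m rule: poly_mapping_induct)
    case (single k n)
    show ?case
    proof (induction n)
      case 0
      show ?case using const[of 1] by simp
    next
      case (Suc n)
      have "Poly_Mapping.single (Poly_Mapping.single k (Suc n)) 1 =
         Poly_Mapping.single (Poly_Mapping.single k 1) 1 * Poly_Mapping.single (Poly_Mapping.single k n) (1::'a)"
        by (simp add: mult_single flip: single_add)
      then show ?case by (simp only: mult[OF var Suc])
    qed
  next
    case (add m l)
    then show ?case using mult[OF add] by (simp add: mult_single)
  qed
  then show ?case by (subst single_split) (intro mult const)
qed (rule add)

text \<open>The derivation that acts by \<open>D\<close> on coefficients, sends the
  \<open>k\<close>-th variable to \<open>V k\<close> and obeys the Leibniz rule twisted by
  \<open>\<alpha>\<close>, which is the identity or, for odd derivations, the parity automorphism.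
  In the sum \<open>\<alpha>\<close> hits the coefficient, since the derivation passes it on the way
  to the variables.\<close>

definition poly_der :: "('a \<Rightarrow> 'a) \<Rightarrow> ('a \<Rightarrow> 'a) \<Rightarrow> (nat \<Rightarrow> (nat \<Rightarrow>\<^sub>0 nat) \<Rightarrow>\<^sub>0 'a) \<Rightarrow>
    ((nat \<Rightarrow>\<^sub>0 nat) \<Rightarrow>\<^sub>0 'a::ring_1) \<Rightarrow> (nat \<Rightarrow>\<^sub>0 nat) \<Rightarrow>\<^sub>0 'a" where
  "poly_der D \<alpha> V = linext (\<lambda>m a. Poly_Mapping.single m (D a) +
     (\<Sum>k\<in>Poly_Mapping.keys m.
        Poly_Mapping.single (m - Poly_Mapping.single k 1) (of_nat (Poly_Mapping.lookup m k) * \<alpha> a) * V k))"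

text \<open>Variables commute with coefficients; expanding the derivation of both orders of such a
  product by the twisted Leibniz rule forces \<open>V_commute\<close>.\<close>

locale poly_derivation =
  fixes D \<alpha> :: "'a::ring_1 \<Rightarrow> 'a" and V :: "nat \<Rightarrow> (nat \<Rightarrow>\<^sub>0 nat) \<Rightarrow>\<^sub>0 'a"
  assumes D_add: "D (a + b) = D a + D b"
    and D_mult: "D (a * b) = D a * b + \<alpha> a * D b"
    and \<alpha>_add: "\<alpha> (a + b) = \<alpha> a + \<alpha> b"
    and \<alpha>_mult: "\<alpha> (a * b) = \<alpha> a * \<alpha> b"
    and \<alpha>_one: "\<alpha> 1 = 1"
    and V_commute: "V k * Poly_Mapping.single 0 a = Poly_Mapping.single 0 (\<alpha> a) * V k"
begin

lemma \<alpha>_zero: "\<alpha> 0 = 0"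
  using \<alpha>_add by (rule additive_zero)

lemma D_one: "D 1 = 0"
  using D_mult[of 1 1] by (simp add: \<alpha>_one)

lemma poly_der_add: "poly_der D \<alpha> V (p + q) = poly_der D \<alpha> V p + poly_der D \<alpha> V q"
  unfolding poly_der_def
  by (rule linext_add) (simp add: single_add D_add \<alpha>_add algebra_simps sum.distrib)

lemma poly_der_single:
  "poly_der D \<alpha> V (Poly_Mapping.single m a) = Poly_Mapping.single m (D a) +
     (\<Sum>k\<in>Poly_Mapping.keys m.
        Poly_Mapping.single (m - Poly_Mapping.single k 1) (of_nat (Poly_Mapping.lookup m k) * \<alpha> a) * V k)"
  unfolding poly_der_def
  by (rule linext_single) (simp add: single_add D_add \<alpha>_add algebra_simps sum.distrib)

lemma poly_der_const: "poly_der D \<alpha> V (Poly_Mapping.single 0 a) = Poly_Mapping.single 0 (D a)"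
  by (simp add: poly_der_single)

lemma poly_der_var: "poly_der D \<alpha> V (Poly_Mapping.single (Poly_Mapping.single k 1) 1) = V k"
  by (simp add: poly_der_single D_one \<alpha>_one)

lemma poly_der_mult:
  "poly_der D \<alpha> V (p * q) = poly_der D \<alpha> V p * q + Poly_Mapping.map \<alpha> p * poly_der D \<alpha> V q"
proof (induction p rule: poly_mapping_induct)
  case (add p p')
  then show ?case
    by (simp add: distrib_right poly_der_add poly_map_add \<alpha>_add \<alpha>_zero)
next
  case (single m a)
  show ?case
  proof (induction q rule: poly_mapping_induct)
    case (add q q')
    then show ?case by (simp add: distrib_left poly_der_add)
  next
    case (single l b)
    let ?e = "\<lambda>k. Poly_Mapping.single k (1::nat)"
    let ?S = "Poly_Mapping.keys m \<union> Poly_Mapping.keys l"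
    let ?s = "\<lambda>m a k. Poly_Mapping.single (m - ?e k) (of_nat (Poly_Mapping.lookup m k) * \<alpha> a) * V k"
    have S: "(\<Sum>k\<in>Poly_Mapping.keys n. ?s n c k) = (\<Sum>k\<in>?S. ?s n c k)"
      if "Poly_Mapping.keys n \<subseteq> ?S" for n c
      using that by (intro sum.mono_neutral_left) (auto simp: in_keys_iff)
    have V1: "V k * Poly_Mapping.single l b = Poly_Mapping.single l (\<alpha> b) * V k" for k
    proof -
      have "V k * Poly_Mapping.single l b = V k * Poly_Mapping.single 0 b * Poly_Mapping.single l 1"
        by (simp add: mult_single mult.assoc)
      also have "\<dots> = Poly_Mapping.single 0 (\<alpha> b) * (Poly_Mapping.single l 1 * V k)"
        by (simp only: V_commute mult.assoc single_one_commute)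
      also have "\<dots> = Poly_Mapping.single l (\<alpha> b) * V k"
        by (simp add: mult_single flip: mult.assoc)
      finally show ?thesis .
    qed
    \<comment> \<open>Subtraction of exponents is truncated. The two monomials can differ only where
      the exponent of \<open>k\<close> in \<open>m\<close> is 0, and there the term carries the
      coefficient 0.\<close>
    have shift: "of_nat (Poly_Mapping.lookup m k) = (0::nat) \<or> n + m - ?e k = n + (m - ?e k)" for m n k
    proof (cases "Poly_Mapping.lookup m k")
      case (Suc j)
      then show ?thesis
        by (intro disjI2 poly_mapping_eqI) (auto simp: lookup_add lookup_minus lookup_single when_def)
    qed simp
    have t1: "Poly_Mapping.single (m + l - ?e k) (of_nat (Poly_Mapping.lookup m k) * \<alpha> (a * b)) =
      Poly_Mapping.single (m - ?e k) (of_nat (Poly_Mapping.lookup m k) * \<alpha> a) * Poly_Mapping.single l (\<alpha> b)" for k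
      using shift[of m k l] by (auto simp: mult_single \<alpha>_mult add.commute mult.assoc)
    have t2: "Poly_Mapping.single (m + l - ?e k) (of_nat (Poly_Mapping.lookup l k) * \<alpha> (a * b)) =
      Poly_Mapping.single m (\<alpha> a) * Poly_Mapping.single (l - ?e k) (of_nat (Poly_Mapping.lookup l k) * \<alpha> b)" for k
      using shift[of l k m]
      by (auto simp: mult_single \<alpha>_mult mult.assoc mult_of_nat_commute)
    have st: "?s (m + l) (a * b) k = ?s m a k * Poly_Mapping.single l b + Poly_Mapping.single m (\<alpha> a) * ?s l b k" for k
    proof -
      have "?s (m + l) (a * b) k = Poly_Mapping.single (m + l - ?e k) (of_nat (Poly_Mapping.lookup m k) * \<alpha> (a * b)) * V k
          + Poly_Mapping.single (m + l - ?e k) (of_nat (Poly_Mapping.lookup l k) * \<alpha> (a * b)) * V k"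
        by (simp add: lookup_add distrib_right single_add)
      then show ?thesis
        by (simp only: t1 t2 mult.assoc V1)
    qed
    have "poly_der D \<alpha> V (Poly_Mapping.single m a * Poly_Mapping.single l b)
       = Poly_Mapping.single (m + l) (D (a * b)) + (\<Sum>k\<in>?S. ?s (m + l) (a * b) k)"
      using S[of "m + l"] keys_add[of m l] by (simp add: mult_single poly_der_single)
    also have "(\<Sum>k\<in>?S. ?s (m + l) (a * b) k) = (\<Sum>k\<in>?S. ?s m a k) * Poly_Mapping.single l b
       + Poly_Mapping.single m (\<alpha> a) * (\<Sum>k\<in>?S. ?s l b k)"
      by (simp only: st sum.distrib sum_distrib_left sum_distrib_right)
    finally show ?case
      using S[of m a] S[of l b]
      by (simp add: poly_der_single D_mult single_add map_single \<alpha>_zero mult_single algebra_simps)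
  qed
qed

end

section \<open>Commutative jet polynomials\<close>

type_synonym 'k jet_poly = "(nat \<Rightarrow>\<^sub>0 nat) \<Rightarrow>\<^sub>0 'k"

definition jet_var :: "nat \<Rightarrow> 'k::comm_ring_1 jet_poly" where
  "jet_var s = Poly_Mapping.single (Poly_Mapping.single s 1) 1"

definition jet_dx :: "'k::comm_ring_1 jet_poly \<Rightarrow> 'k jet_poly" where
  "jet_dx = poly_der (\<lambda>_. 0) id (\<lambda>s. jet_var (Suc s))"

definition jet_partial :: "nat \<Rightarrow> 'k::comm_ring_1 jet_poly \<Rightarrow> 'k jet_poly" where
  "jet_partial s = poly_der (\<lambda>_. 0) id (\<lambda>k. if k = s then 1 else 0)"

lemma poly_derivation_comm:
  "poly_derivation (\<lambda>_. 0) id (V :: nat \<Rightarrow> 'k::comm_ring_1 jet_poly)"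
  by standard (simp_all add: mult.commute)

lemma poly_map_id [simp]: "Poly_Mapping.map id p = p"
  by (rule poly_mapping_eqI) (simp add: lookup_map_zero)

lemma jet_dx_add: "jet_dx (p + q) = jet_dx p + jet_dx q"
  unfolding jet_dx_def by (rule poly_derivation.poly_der_add[OF poly_derivation_comm])

lemma jet_dx_const: "jet_dx (Poly_Mapping.single 0 c) = 0"
  unfolding jet_dx_def by (simp add: poly_derivation.poly_der_const[OF poly_derivation_comm])

lemma jet_dx_var: "jet_dx (jet_var s) = jet_var (Suc s)"
  unfolding jet_dx_def by (subst jet_var_def) (rule poly_derivation.poly_der_var[OF poly_derivation_comm])

lemma jet_dx_mult: "jet_dx (p * q) = jet_dx p * q + p * jet_dx q"
  unfolding jet_dx_def by (simp add: poly_derivation.poly_der_mult[OF poly_derivation_comm])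

lemma jet_partial_add: "jet_partial s (p + q) = jet_partial s p + jet_partial s q"
  unfolding jet_partial_def by (rule poly_derivation.poly_der_add[OF poly_derivation_comm])

lemma jet_partial_const: "jet_partial s (Poly_Mapping.single 0 c) = 0"
  unfolding jet_partial_def by (simp add: poly_derivation.poly_der_const[OF poly_derivation_comm])

lemma jet_partial_var: "jet_partial s (jet_var k) = (if k = s then 1 else 0)"
  unfolding jet_partial_def jet_var_def by (rule poly_derivation.poly_der_var[OF poly_derivation_comm])

lemma jet_partial_mult: "jet_partial s (p * q) = jet_partial s p * q + p * jet_partial s q"
  unfolding jet_partial_def by (simp add: poly_derivation.poly_der_mult[OF poly_derivation_comm])

text \<open>The classical commutator [\<partial>/\<partial>u^(s+1), d/dx] =
  \<partial>/\<partial>u^(s). Both sides of it are derivations that kill the scalars, so the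
  variables decide.\<close>

lemma jet_partial_Suc_dx:
  "jet_partial (Suc s) (jet_dx p) = jet_dx (jet_partial (Suc s) p) + jet_partial s p"
proof (induction p rule: poly_var_induct)
  case (var k)
  have one: "jet_dx 1 = (0 :: 'a jet_poly)"
    using jet_dx_const[of 1] by simp
  have zero: "jet_dx 0 = (0 :: 'a jet_poly)"
    using jet_dx_const[of 0] by simp
  show ?case
    unfolding jet_var_def[symmetric] by (simp add: jet_dx_var jet_partial_var one zero)
qed (simp_all add: jet_dx_const jet_partial_const jet_dx_add jet_partial_add jet_dx_mult
    jet_partial_mult jet_dx_const[of 0, simplified] jet_partial_const[of _ 0, simplified] algebra_simps)

text \<open>Euler's operator for a single variable: monomials are eigenvectors, with the exponent at
  \<open>s\<close> as eigenvalue. If all partial derivatives vanish, this leaves only the constant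
  term.\<close>

lemma euler_jet_partial:
  "Poly_Mapping.lookup (jet_var s * jet_partial s p) m
     = of_nat (Poly_Mapping.lookup m s) * Poly_Mapping.lookup p m"
proof (induction p rule: poly_mapping_induct)
  case (single l c)
  have sum: "(\<Sum>k\<in>Poly_Mapping.keys l. Poly_Mapping.single (l - Poly_Mapping.single k 1)
        (of_nat (Poly_Mapping.lookup l k) * c) * (if k = s then 1 else 0))
      = Poly_Mapping.single (l - Poly_Mapping.single s 1) (of_nat (Poly_Mapping.lookup l s) * c)"
    by (cases "s \<in> Poly_Mapping.keys l")
      (simp_all add: if_distrib sum.delta in_keys_iff cong: if_cong)
  have "Poly_Mapping.single s 1 + (l - Poly_Mapping.single s 1) = l" if "Poly_Mapping.lookup l s \<noteq> 0"
    using that by (intro poly_mapping_eqI) (auto simp: lookup_add lookup_minus lookup_single when_def)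
  then have "jet_var s * jet_partial s (Poly_Mapping.single l c) =
      Poly_Mapping.single l (of_nat (Poly_Mapping.lookup l s) * c)"
    unfolding jet_partial_def poly_derivation.poly_der_single[OF poly_derivation_comm] id_apply sum
    by (cases "Poly_Mapping.lookup l s = 0") (simp_all add: jet_var_def mult_single)
  then show ?case by (simp add: lookup_single when_def)
qed (simp add: jet_partial_add lookup_add distrib_left)

text \<open>Only finitely many jets occur in a polynomial; this starts a descending induction on the
  order of the jet.\<close>

lemma jet_partial_finite:
  fixes p :: "'k::comm_ring_1 jet_poly"
  shows "\<exists>S. \<forall>s\<ge>S. jet_partial s p = 0"
proof (induction p rule: poly_var_induct)
  case (var k)
  show ?case
    by (rule exI[of _ "Suc k"], unfold jet_var_def[symmetric]) (auto simp: jet_partial_var)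
next
  case (add p q)
  then obtain S T where "\<forall>s\<ge>S. jet_partial s p = 0" "\<forall>s\<ge>T. jet_partial s q = 0" by blast
  then show ?case by (intro exI[of _ "max S T"]) (simp add: jet_partial_add)
next
  case (mult p q)
  then obtain S T where "\<forall>s\<ge>S. jet_partial s p = 0" "\<forall>s\<ge>T. jet_partial s q = 0" by blast
  then show ?case by (intro exI[of _ "max S T"]) (simp add: jet_partial_mult)
qed (simp add: jet_partial_const)

lemma of_nat_mult_cancel_zero:
  fixes c :: "'k::real_algebra_1"
  assumes "of_nat n * c = 0" "n \<noteq> 0"
  shows "c = 0"
proof -
  have "real n *\<^sub>R c = 0"
    using assms(1) by (simp add: scaleR_conv_of_real)
  then show ?thesis using assms(2) by simp
qed

text \<open>If \<open>jet_dx p = 0\<close>, then \<open>jet_partial_Suc_dx\<close> expresses each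
  partial derivative of \<open>p\<close> by the derivative of the next higher one. So vanishing
  descends from high orders to all orders, and \<open>euler_jet_partial\<close> finishes.\<close>

lemma jet_dx_kernel:
  fixes p :: "'k::kdv_scalars jet_poly"
  assumes dx: "jet_dx p = 0" and const: "Poly_Mapping.lookup p 0 = 0"
  shows "p = 0"
proof -
  obtain S where S: "\<forall>s\<ge>S. jet_partial s p = 0"
    using jet_partial_finite by blast
  \<comment> \<open>Descending induction from \<open>S\<close>; for \<open>j\<close> beyond
    \<open>S\<close> the truncated index stays at 0.\<close>
  have "jet_partial (S - j) p = 0" for j
  proof (induction j)
    case (Suc j)
    show ?case
    proof (cases "j < S")
      case True
      then have "Suc (S - Suc j) = S - j" by simp
      with jet_partial_Suc_dx[of "S - Suc j" p] Suc show ?thesis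
        by (simp add: dx jet_dx_const[of 0, simplified] jet_partial_const[of _ 0, simplified])
    qed (use Suc in simp)
  qed (use S in simp)
  then have partial: "jet_partial s p = 0" for s
    using S by (metis diff_diff_cancel nat_le_linear)
  show ?thesis
  proof (rule poly_mapping_eqI)
    fix m
    show "Poly_Mapping.lookup p m = Poly_Mapping.lookup 0 m"
    proof (cases "m = 0")
      case False
      then obtain s where "Poly_Mapping.lookup m s \<noteq> 0"
        by (metis lookup_zero poly_mapping_eqI)
      moreover have "of_nat (Poly_Mapping.lookup m s) * Poly_Mapping.lookup p m = 0"
        using euler_jet_partial[of s p m] by (simp add: partial)
      ultimately have "Poly_Mapping.lookup p m = 0"
        by (rule of_nat_mult_cancel_zero[rotated])
      then show ?thesis by simp
    qed (simp add: const)
  qed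
qed

section \<open>The differential ring and its grading\<close>

abbreviation fmono :: "gen list \<Rightarrow> 'k::kdv_scalars freealg" where
  "fmono gs \<equiv> Poly_Mapping.single (Word gs) 1"

lemma fmono_Nil: "fmono [] = 1"
  by (simp add: zero_word_def[symmetric])

lemma fmono_Cons: "fmono (g # gs) = fgen g * fmono gs"
  by (simp add: fgen_def mult_single plus_word_def)

lemma fmono_append: "fmono (gs @ hs) = fmono gs * fmono hs"
  by (simp add: mult_single plus_word_def)

lemma single_fmono: "Poly_Mapping.single w c = fscal c * fmono (letters w)"
  by (simp add: fscal_def mult_single)

lemma fscal_add: "fscal (c + d) = fscal c + fscal d"
  and fscal_mult: "fscal (c * d) = fscal c * fscal d"
  and fscal_0: "fscal 0 = 0"
  and fscal_1: "fscal 1 = 1"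
  by (simp_all add: fscal_def single_add mult_single)

lemma freealg_induct [case_names scal gen add mult]:
  fixes a :: "'k::kdv_scalars freealg"
  assumes scal: "\<And>c. P (fscal c)" and gen: "\<And>g. P (fgen g)"
    and add: "\<And>a b. P a \<Longrightarrow> P b \<Longrightarrow> P (a + b)"
    and mult: "\<And>a b. P a \<Longrightarrow> P b \<Longrightarrow> P (a * b)"
  shows "P a"
proof (induction a rule: poly_mapping_induct)
  case (single w c)
  have "P (fmono gs)" for gs
    by (induction gs) (use scal[of 1] in \<open>simp add: fmono_Nil fscal_1\<close>, simp only: fmono_Cons mult gen)
  then show ?case by (subst single_fmono) (intro mult scal)
qed (rule add)

lemma fscal_commute: "fscal c * a = a * fscal c"
  by (induction a rule: poly_mapping_induct) (simp_all add: fscal_def mult_single mult.commute algebra_simps)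

lemma fscal_left_commute: "a * (fscal c * b) = fscal c * (a * b)"
  by (simp only: mult.assoc[symmetric] fscal_commute[of c a])

lemma fdx_single: "fdx (Poly_Mapping.single w c) = fscal c * fdx_word w"
  by (simp add: fdx_def fscal_0)

lemma fdx_word_Cons: "fdx_word (Word (g # gs)) = fgen (next_gen g) * fmono gs + fgen g * fdx_word (Word gs)"
  unfolding fdx_word_def
  by (simp add: sum.lessThan_Suc_shift fgen_def mult_single plus_word_def sum_distrib_left
      del: sum.lessThan_Suc)

lemma fdx_word_append:
  "fdx_word (Word (gs @ hs)) = fdx_word (Word gs) * fmono hs + fmono gs * fdx_word (Word hs)"
proof (induction gs)
  case Nil
  show ?case by (simp add: fmono_Nil) (simp add: fdx_word_def)
next
  case (Cons g gs)
  then show ?case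
    by (simp add: fdx_word_Cons fmono_Cons fmono_append algebra_simps)
qed

lemma fdx_mult: "fdx (a * b) = fdx a * b + a * fdx b"
proof (induction a rule: poly_mapping_induct)
  case (single w c)
  show ?case
  proof (induction b rule: poly_mapping_induct)
    case (single w' d)
    have "fdx (fscal c * fmono (letters w) * (fscal d * fmono (letters w')))
       = fscal c * (fscal d * fdx_word (w + w'))"
      by (simp only: flip: single_fmono) (simp add: mult_single fdx_single fscal_mult mult.assoc)
    also have "fdx_word (w + w') = fdx_word w * fmono (letters w') + fmono (letters w) * fdx_word w'"
      using fdx_word_append[of "letters w" "letters w'"] by (simp add: plus_word_def)
    also have "fscal c * (fscal d * (fdx_word w * fmono (letters w') + fmono (letters w) * fdx_word w'))
      = fscal c * fdx_word w * (fscal d * fmono (letters w')) + fscal c * fmono (letters w) * (fscal d * fdx_word w')"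
      by (simp add: distrib_left mult.assoc fscal_left_commute[of "fdx_word w"]
          fscal_left_commute[of "Poly_Mapping.single w 1"])
    finally show ?case
      by (simp only: fdx_single flip: single_fmono)
  qed (simp add: distrib_left fdx_add)
qed (simp add: distrib_right fdx_add)

lemma fdx_fscal: "fdx (fscal c) = 0"
  unfolding fscal_def fdx_single by (simp add: fdx_word_def zero_word_def)



section \<open>Generators, scalars and the derivation in the quotient\<close>

lemma abs_sdiff_eq_iff: "abs_sdiff a = abs_sdiff b \<longleftrightarrow> a - b \<in> rel_ideal"
  using sdiff.abs_eq_iff by (simp add: rel_cong_def)

lemma abs_sdiff_eq_0_iff: "abs_sdiff a = 0 \<longleftrightarrow> a \<in> rel_ideal"
  unfolding zero_sdiff_def abs_sdiff_eq_iff by simp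

lemmas abs_sdiff_simps = plus_sdiff.abs_eq[symmetric] minus_sdiff.abs_eq[symmetric]
  uminus_sdiff.abs_eq[symmetric] times_sdiff.abs_eq[symmetric] one_sdiff_def[symmetric]
  zero_sdiff_def[symmetric] dx.abs_eq[symmetric] scal.abs_eq[symmetric]

definition jet :: "gen \<Rightarrow> 'k::kdv_scalars sdiff" where
  "jet g = abs_sdiff (fgen g)"

lemma jet_next: "jet (next_gen g) = dx (jet g)"
  by (simp add: jet_def dx.abs_eq fdx_fgen)

lemma jet_u: "jet (Ujet 0) = u_var"
  by (simp add: jet_def u_var.abs_eq)

lemma jet_sigma: "jet (Sjet k 0) = \<sigma> k"
  by (simp add: jet_def \<sigma>.abs_eq)

lemma sdiff_jet_induct [case_names scal jet add mult]:
  fixes a :: "'k::kdv_scalars sdiff"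
  assumes "\<And>c. P (scal c)" "\<And>g. P (jet g)"
    and "\<And>a b. P a \<Longrightarrow> P b \<Longrightarrow> P (a + b)"
    and "\<And>a b. P a \<Longrightarrow> P b \<Longrightarrow> P (a * b)"
  shows "P a"
proof -
  have "P (abs_sdiff a)" for a
    by (induction a rule: freealg_induct) (use assms in \<open>simp_all add: abs_sdiff_simps flip: jet_def\<close>)
  then show ?thesis by (rule sdiff.abs_induct)
qed

lemma sdiff_induct [case_names scal u sigma dx add mult]:
  fixes a :: "'k::kdv_scalars sdiff"
  assumes scal: "\<And>c. P (scal c)" and u: "P u_var" and sigma: "\<And>k. P (\<sigma> k)"
    and dx: "\<And>a. P a \<Longrightarrow> P (dx a)"
    and add: "\<And>a b. P a \<Longrightarrow> P b \<Longrightarrow> P (a + b)"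
    and mult: "\<And>a b. P a \<Longrightarrow> P b \<Longrightarrow> P (a * b)"
  shows "P a"
proof (induction a rule: sdiff_jet_induct)
  case (jet g)
  have "P (jet (Ujet s))" for s
    by (induction s) (use u in \<open>simp add: jet_u\<close>, metis dx jet_next next_gen.simps(1))
  moreover have "P (jet (Sjet k s))" for k s
    by (induction s) (use sigma in \<open>simp add: jet_sigma\<close>, metis dx jet_next next_gen.simps(2))
  ultimately show ?case by (cases g) auto
qed (rule scal add mult; assumption)+

lemma dx_add: "dx (a + b) = dx a + dx b"
  by transfer (simp add: rel_cong_def fdx_add rel_ideal.zero)

lemma dx_uminus: "dx (- a) = - dx a"
  using dx_add by (rule additive_uminus)

lemma dx_diff: "dx (a - b) = dx a - dx b"
  using dx_add by (rule additive_diff)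

lemma dx_mult: "dx (a * b) = dx a * b + a * dx b"
  by transfer (simp add: rel_cong_def fdx_mult rel_ideal.zero)

lemma dx_scal: "dx (scal c) = 0"
  by transfer (simp add: rel_cong_def fdx_fscal rel_ideal.zero)

lemma dx_0: "dx 0 = 0"
  using dx_add by (rule additive_zero)

lemma scal_add: "scal (c + d) = scal c + scal d"
  and scal_mult: "scal (c * d) = scal c * scal d"
  and scal_1: "scal 1 = 1"
  by (transfer; simp add: rel_cong_def fscal_add fscal_mult fscal_1 rel_ideal.zero)+

lemma scal_commute: "scal c * a = a * scal c"
  by transfer (simp add: rel_cong_def fscal_commute rel_ideal.zero)

lemma scal_left_commute: "a * (scal c * b) = scal c * (a * b)"
  by (simp only: mult.assoc[symmetric] scal_commute[of c a])

lemma dx_1: "dx 1 = 0"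
  using dx_scal[of 1] by (simp add: scal_1)

lemma scal_half: "scal (of_real (1/2)) * (a + a) = (a :: 'k::kdv_scalars sdiff)"
proof -
  have "scal (of_real (1/2)) * (a + a) = (scal (of_real (1/2)) + scal (of_real (1/2))) * a"
    by (simp add: algebra_simps)
  also have "\<dots> = a"
    by (simp add: scal_1 flip: scal_add of_real_add)
  finally show ?thesis .
qed

lemma sdiff_double_eq_iff: "a + a = b + b \<longleftrightarrow> a = (b :: 'k::kdv_scalars sdiff)"
  by (metis scal_half)

lemma sdiff_double_eq_0_iff: "a + a = 0 \<longleftrightarrow> a = (0 :: 'k::kdv_scalars sdiff)"
  using sdiff_double_eq_iff[of a 0] by simp

lemma sdiff_eq_neg_iff: "a = - a \<longleftrightarrow> a = (0 :: 'k::kdv_scalars sdiff)"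
  using sdiff_double_eq_0_iff[of a] by (simp add: eq_neg_iff_add_eq_0)


section \<open>The parity automorphism and graded commutativity\<close>

definition fgrade :: "'k::kdv_scalars freealg \<Rightarrow> 'k freealg" where
  "fgrade = Poly_Mapping.mapp (\<lambda>w c. (-1) ^ super_degree w * c)"

lemma lookup_fgrade: "Poly_Mapping.lookup (fgrade a) w = (-1) ^ super_degree w * Poly_Mapping.lookup a w"
  by (simp add: fgrade_def lookup_mapp when_def in_keys_iff)

lemma keys_fgrade: "Poly_Mapping.keys (fgrade a) = Poly_Mapping.keys a"
  by (auto simp: in_keys_iff lookup_fgrade) (metis minus_one_power_iff mult_1 mult_minus1 neg_equal_0_iff_equal)

lemma fgrade_add: "fgrade (a + b) = fgrade a + fgrade b"
  by (rule poly_mapping_eqI) (simp add: lookup_fgrade lookup_add distrib_left)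

lemma fgrade_single: "fgrade (Poly_Mapping.single w c) = Poly_Mapping.single w ((-1) ^ super_degree w * c)"
  by (rule poly_mapping_eqI) (simp add: lookup_fgrade lookup_single when_def)

lemma super_degree_plus: "super_degree (v + w) = super_degree v + super_degree w"
  by (simp add: super_degree_def plus_word_def)

lemma super_degree_0: "super_degree 0 = 0"
  by (simp add: super_degree_def zero_word_def)

lemma fgrade_mult: "fgrade (a * b) = fgrade a * fgrade b"
proof (induction a rule: poly_mapping_induct)
  case (single v c)
  show ?case
    by (induction b rule: poly_mapping_induct)
      (simp_all add: fgrade_single mult_single fgrade_add super_degree_plus power_add distrib_left algebra_simps)
qed (simp add: fgrade_add distrib_right)

lemma fgrade_fscal: "fgrade (fscal c) = fscal c"
  by (simp add: fscal_def fgrade_single super_degree_0)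

lemma fgrade_fgen: "fgrade (fgen g) = (if is_odd_gen g then - fgen g else fgen g)"
  by (simp add: fgen_def fgrade_single super_degree_def single_uminus)

lemma fgrade_uminus: "fgrade (- a) = - fgrade a"
  using fgrade_add by (rule additive_uminus)

lemma fgrade_diff: "fgrade (a - b) = fgrade a - fgrade b"
  using fgrade_add by (rule additive_diff)

lemma is_odd_gen_next: "is_odd_gen (next_gen g) = is_odd_gen g"
  by (cases g) auto

lemma fgrade_fdx: "fgrade (fdx a) = fdx (fgrade a)"
  by (induction a rule: freealg_induct)
    (simp_all add: fdx_fscal fgrade_fscal fdx_fgen fgrade_fgen is_odd_gen_next fdx_uminus
      fgrade_add fdx_add fgrade_mult fdx_mult additive_zero[OF fgrade_add])

lemma fgrade_fP1: "fgrade (fP1 a) = fP1 (fgrade a)"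
  by (simp add: fP1_def fgrade_add fgrade_mult fgrade_fgen fgrade_fscal fgrade_fdx)

lemma fP1_uminus: "fP1 (- a) = - fP1 a"
  by (simp add: fP1_def fdx_uminus)

text \<open>The commutators and the relations between the odd variables are eigenvectors with
  eigenvalue 1 or -1, and the rule \<open>odd_const\<close> is stable because a change of signs
  keeps the set of keys.\<close>

lemma fgrade_rel_ideal: "a \<in> rel_ideal \<Longrightarrow> fgrade a \<in> rel_ideal"
proof (induction rule: rel_ideal.induct)
  case (scomm g h)
  have one: "fgrade (if P then - 1 else 1) = (if P then - 1 else (1 :: 'a freealg))" for P
    using fgrade_fscal[of 1] by (simp add: fscal_1 fgrade_uminus)
  define r :: "'a freealg" where
    "r = fgen g * fgen h - (if is_odd_gen g \<and> is_odd_gen h then -1 else 1) * (fgen h * fgen g)"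
  have "fgrade r = r \<or> fgrade r = - r"
    unfolding r_def by (simp only: fgrade_diff fgrade_mult one fgrade_fgen) (cases "is_odd_gen g"; cases "is_odd_gen h"; simp)
  moreover have "r \<in> rel_ideal"
    unfolding r_def by (rule rel_ideal.scomm)
  ultimately show ?case
    unfolding r_def[symmetric] using rel_ideal_uminus by metis
next
  case (sigma k)
  have "fgrade (fdx (fgen (Sjet (Suc k) 0)) - fP1 (fgen (Sjet k 0)))
      = - (fdx (fgen (Sjet (Suc k) 0)) - fP1 (fgen (Sjet k 0) :: 'a freealg))"
    by (simp add: fgrade_diff fgrade_fdx fgrade_fP1 fgrade_fgen fdx_uminus fP1_uminus)
  then show ?case using rel_ideal_uminus[OF rel_ideal.sigma] by simp
next
  case (odd_const a)
  show ?case
    by (rule rel_ideal.odd_const) (use odd_const in \<open>simp_all add: keys_fgrade flip: fgrade_fdx\<close>)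
qed (simp_all add: additive_zero[OF fgrade_add] fgrade_add fgrade_mult fgrade_fdx
    rel_ideal.zero rel_ideal.add rel_ideal.mult rel_ideal.dx)

lift_definition grade :: "'k::kdv_scalars sdiff \<Rightarrow> 'k sdiff" is fgrade
  unfolding rel_cong_def by (metis fgrade_diff fgrade_rel_ideal)

lemma grade_add: "grade (a + b) = grade a + grade b"
  by transfer (simp add: rel_cong_def fgrade_add rel_ideal.zero)

lemma grade_0: "grade 0 = 0"
  using grade_add by (rule additive_zero)

lemma grade_uminus: "grade (- a) = - grade a"
  using grade_add by (rule additive_uminus)

lemma grade_diff: "grade (a - b) = grade a - grade b"
  using grade_add by (rule additive_diff)

lemma grade_mult: "grade (a * b) = grade a * grade b"
  by transfer (simp add: rel_cong_def fgrade_mult rel_ideal.zero)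

lemma grade_dx: "grade (dx a) = dx (grade a)"
  by transfer (simp add: rel_cong_def fgrade_fdx rel_ideal.zero)

lemma grade_scal: "grade (scal c) = scal c"
  by transfer (simp add: rel_cong_def fgrade_fscal rel_ideal.zero)

lemma grade_1: "grade 1 = 1"
  using grade_scal[of 1] by (simp add: scal_1)

lemma grade_jet: "grade (jet g) = (if is_odd_gen g then - jet g else jet g)"
  unfolding jet_def grade.abs_eq fgrade_fgen by (simp add: abs_sdiff_simps)

lemma grade_u: "grade u_var = u_var"
  using grade_jet[of "Ujet 0"] by (simp add: jet_u)

lemma grade_sigma: "grade (\<sigma> k) = - \<sigma> k"
  using grade_jet[of "Sjet k 0"] by (simp add: jet_sigma)

lemma grade_grade: "grade (grade a) = a"
  by (induction a rule: sdiff_jet_induct) (simp_all add: grade_scal grade_jet grade_uminus grade_add grade_mult)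

text \<open>Parity becomes an eigenvalue equation, which can be verified by calculation in the
  quotient, without choosing representatives.\<close>

lemma parity_iff: "a \<in> parity q \<longleftrightarrow> grade a = (if q then - a else a)"
proof
  assume "a \<in> parity q"
  then obtain b where b: "a = abs_sdiff b" "\<forall>w\<in>Poly_Mapping.keys b. odd (super_degree w) = q"
    by (auto simp: parity_def)
  then have "fgrade b = (if q then - b else b)"
    by (intro poly_mapping_eqI) (auto simp: lookup_fgrade in_keys_iff minus_one_power_iff)
  then show "grade a = (if q then - a else a)"
    by (auto simp: b grade.abs_eq abs_sdiff_simps)
next
  assume a: "grade a = (if q then - a else a)"
  obtain b where b: "a = abs_sdiff b"
    using Quotient_abs_rep[OF Quotient_sdiff, of a] by metis
  \<comment> \<open>Symmetrising an arbitrary representative cancels the words of the wrong parity;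
    by the assumption on \<open>a\<close> the class stays the same.\<close>
  define c where "c = fscal (of_real (1/2)) * (b + (if q then - fgrade b else fgrade b))"
  have "abs_sdiff c = scal (of_real (1/2)) * (a + (if q then - grade a else grade a))"
    by (simp add: c_def b grade.abs_eq abs_sdiff_simps)
  also have "\<dots> = a" using scal_half by (simp add: a)
  finally have "abs_sdiff c = a" .
  moreover have "\<forall>w\<in>Poly_Mapping.keys c. odd (super_degree w) = q"
  proof -
    have "Poly_Mapping.lookup (fscal d * f) w = d * Poly_Mapping.lookup f w" for d :: 'a and f w
      by (induction f rule: poly_mapping_induct)
        (simp_all add: fscal_def mult_single lookup_single when_def lookup_add distrib_left)
    then show ?thesis
      by (auto simp: c_def in_keys_iff lookup_add lookup_minus lookup_fgrade minus_one_power_iff split: if_splits)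
  qed
  ultimately show "a \<in> parity q" by (auto simp: parity_def)
qed

text \<open>Writing the sign as an application of \<open>grade\<close> covers inhomogeneous
  \<open>b\<close>, so the induction passes through sums.\<close>

lemma jet_supercommute: "jet g * b = (if is_odd_gen g then grade b else b) * jet g"
proof (induction b rule: sdiff_jet_induct)
  case (jet h)
  have "jet g * jet h - (if is_odd_gen g \<and> is_odd_gen h then -1 else 1) * (jet h * jet g) = 0"
    using rel_ideal.scomm[of g h] by (auto simp: jet_def abs_sdiff_simps abs_sdiff_eq_0_iff[symmetric])
  then show ?case by (auto simp: grade_jet split: if_splits)
next
  case (mult a b)
  have "jet g * (a * b) = (if is_odd_gen g then grade a else a) * (jet g * b)"
    by (simp only: mult.IH(1) flip: mult.assoc)
  then show ?case by (simp add: mult.IH(2) grade_mult mult.assoc)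
qed (auto simp: grade_scal grade_add scal_commute algebra_simps)

text \<open>The elements \<open>a + grade a\<close> and \<open>a - grade a\<close> are twice the
  even and the odd part of \<open>a\<close>. Both claims are additive in \<open>a\<close>, so words
  suffice, and \<open>jet_supercommute\<close> pushes \<open>b\<close> through a word letter by
  letter.\<close>

lemma even_odd_supercommute:
  "(a + grade a) * b = b * (a + grade a) \<and> (a - grade a) * b = grade b * (a - grade a)"
proof -
  have mono: "abs_sdiff (fmono gs) * b = (if odd (super_degree (Word gs)) then grade b else b) * abs_sdiff (fmono gs)"
    for gs and b :: "'a sdiff"
  proof (induction gs arbitrary: b)
    case Nil
    then show ?case by (simp add: fmono_Nil abs_sdiff_simps super_degree_def)
  next
    case (Cons g gs)
    show ?case
      unfolding fmono_Cons abs_sdiff_simps jet_def[symmetric] mult.assoc Cons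
      by (subst (1) mult.assoc[symmetric], subst jet_supercommute)
        (auto simp: super_degree_def grade_grade mult.assoc)
  qed
  have "(abs_sdiff a + grade (abs_sdiff a)) * b = b * (abs_sdiff a + grade (abs_sdiff a)) \<and>
     (abs_sdiff a - grade (abs_sdiff a)) * b = grade b * (abs_sdiff a - grade (abs_sdiff a))" for a
  proof (induction a rule: poly_mapping_induct)
    case (single w c)
    define m :: "'a sdiff" where "m = abs_sdiff (fmono (letters w))"
    have w: "abs_sdiff (Poly_Mapping.single w c) = scal c * m"
      by (subst single_fmono) (simp add: m_def abs_sdiff_simps)
    have gm: "grade m = (if odd (super_degree w) then - m else m)"
      by (simp add: m_def grade.abs_eq fgrade_single minus_one_power_iff single_uminus uminus_sdiff.abs_eq[symmetric])
    have mb: "m * b = (if odd (super_degree w) then grade b else b) * m"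
      using mono[of "letters w"] by (simp add: m_def)
    have sc: "x * (scal c * m) = scal c * (x * m)" for x
      by (simp only: mult.assoc[symmetric] scal_commute[of c x])
    show ?case
      unfolding w grade_mult grade_scal gm
      by (auto simp: mb mult.assoc distrib_left distrib_right sc)
  next
    case (add a a')
    define e d where "e x = x + grade x" and "d x = x - grade x" for x :: "'a sdiff"
    have "e (x + y) = e x + e y" "d (x + y) = d x + d y" for x y
      by (simp_all add: e_def d_def grade_add)
    with add show ?case
      unfolding abs_sdiff_simps e_def[symmetric] d_def[symmetric] by (simp add: distrib_left distrib_right)
  qed
  then show ?thesis by (rule sdiff.abs_induct)
qed

lemma even_commute:
  assumes "grade a = a"
  shows "a * b = b * a"
  using even_odd_supercommute[of a b]
  by (simp add: assms distrib_left distrib_right sdiff_double_eq_iff)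

lemma odd_supercommute:
  assumes "grade a = - a"
  shows "a * b = grade b * a"
  using even_odd_supercommute[of a b]
  by (simp add: assms distrib_left distrib_right sdiff_double_eq_iff)

lemma odd_odd_anticommute:
  assumes "grade a = - a" "grade b = - b"
  shows "a * b = - (b * a)"
  using odd_supercommute[OF assms(1), of b] by (simp add: assms)


section \<open>Constants of the differential ring\<close>

lift_definition aug :: "'k::kdv_scalars sdiff \<Rightarrow> 'k" is "\<lambda>a. Poly_Mapping.lookup a 0"
  using rel_ideal_no_constant by (fastforce simp: rel_cong_def lookup_minus)

lemma aug_add: "aug (a + b) = aug a + aug b"
  by transfer (simp add: lookup_add)

lemma aug_mult: "aug (a * b) = aug a * aug b"
  by transfer (rule lookup_mult_zero_word)

lemma aug_dx: "aug (dx a) = 0"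
  by transfer (rule lookup_fdx_zero)

lemma aug_0: "aug 0 = 0"
  by transfer simp

lemma aug_uminus: "aug (- a) = - aug a"
  using aug_add by (rule additive_uminus)

lemma aug_diff: "aug (a - b) = aug a - aug b"
  using aug_add by (rule additive_diff)

lemma aug_jet: "aug (jet g) = 0"
  unfolding jet_def aug.abs_eq by (rule lookup_fgen_zero)

lemma aug_u: "aug u_var = 0"
  using aug_jet[of "Ujet 0"] by (simp add: jet_u)

section \<open>Comparison with commutative jet polynomials\<close>

fun jet_mon :: "gen list \<Rightarrow> nat \<Rightarrow>\<^sub>0 nat" where
  "jet_mon [] = 0"
| "jet_mon (Ujet s # gs) = Poly_Mapping.single s 1 + jet_mon gs"
| "jet_mon (Sjet k s # gs) = jet_mon gs"

text \<open>The homomorphism that sets the odd jets to zero and lets the even jets commute.\<close>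

definition jet_hom :: "'k::kdv_scalars freealg \<Rightarrow> 'k jet_poly" where
  "jet_hom = linext (\<lambda>w c. if super_degree w = 0 then Poly_Mapping.single (jet_mon (letters w)) c else 0)"

lemma jet_mon_append: "jet_mon (gs @ hs) = jet_mon gs + jet_mon hs"
  by (induction gs rule: jet_mon.induct) (simp_all add: add.assoc)

lemma jet_hom_add: "jet_hom (a + b) = jet_hom a + jet_hom b"
  unfolding jet_hom_def by (rule linext_add) (simp add: single_add)

lemma jet_hom_single: "jet_hom (Poly_Mapping.single w c) =
    (if super_degree w = 0 then Poly_Mapping.single (jet_mon (letters w)) c else 0)"
  unfolding jet_hom_def by (rule linext_single) (simp add: single_add)

lemma jet_hom_mult: "jet_hom (a * b) = jet_hom a * jet_hom b"
proof (induction a rule: poly_mapping_induct)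
  case (single v c)
  show ?case
  proof (induction b rule: poly_mapping_induct)
    case (single w d)
    show ?case
      by (simp add: mult_single jet_hom_single super_degree_plus)
        (simp add: plus_word_def jet_mon_append)
  qed (simp add: jet_hom_add distrib_left)
qed (simp add: jet_hom_add distrib_right)

lemma jet_hom_diff: "jet_hom (a - b) = jet_hom a - jet_hom b"
  using jet_hom_add by (rule additive_diff)

lemma jet_hom_fscal: "jet_hom (fscal c) = Poly_Mapping.single 0 c"
  unfolding fscal_def jet_hom_single super_degree_0 by (simp add: zero_word_def)

lemma jet_hom_fgen: "jet_hom (fgen g) = (case g of Ujet s \<Rightarrow> jet_var s | Sjet k s \<Rightarrow> 0)"
  by (simp add: fgen_def jet_hom_single super_degree_def jet_var_def split: gen.split)

lemma jet_hom_fdx: "jet_hom (fdx a) = jet_dx (jet_hom a)"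
proof (induction a rule: freealg_induct)
  case (gen g)
  then show ?case
    by (cases g) (simp_all add: fdx_fgen jet_hom_fgen jet_dx_var jet_dx_const[of 0, simplified])
qed (simp_all add: jet_hom_add jet_hom_mult jet_hom_fscal fdx_add fdx_mult fdx_fscal jet_dx_add
    jet_dx_mult jet_dx_const additive_zero[OF jet_hom_add])

text \<open>The rule \<open>odd_const\<close> adds only elements supported in positive super degree,
  and these are killed word by word.\<close>

lemma jet_hom_rel_ideal: "a \<in> rel_ideal \<Longrightarrow> jet_hom a = 0"
proof (induction rule: rel_ideal.induct)
  case (scomm g h)
  then show ?case
    by (cases g; cases h) (simp_all add: jet_hom_diff jet_hom_add jet_hom_mult jet_hom_fgen)
next
  case (sigma k)
  then show ?case
    by (simp add: jet_hom_diff jet_hom_add jet_hom_mult jet_hom_fdx jet_hom_fgen fP1_def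
        jet_dx_const[of 0, simplified])
next
  case (odd_const a)
  then show ?case
    unfolding jet_hom_def linext_def by (intro sum.neutral) (metis less_numeral_extra(3))
qed (simp_all add: jet_hom_add jet_hom_mult jet_hom_fdx additive_zero[OF jet_hom_add]
    jet_dx_const[of 0, simplified])

lemma jet_mon_eq_0_iff:
  assumes "super_degree (Word gs) = 0"
  shows "jet_mon gs = 0 \<longleftrightarrow> gs = []"
proof (cases gs rule: jet_mon.cases)
  case (2 s hs)
  have "Poly_Mapping.lookup (jet_mon gs) s \<noteq> 0" by (simp add: 2 lookup_add)
  then show ?thesis using 2 by auto
qed (use assms in \<open>simp_all add: super_degree_def\<close>)

lemma lookup_jet_hom_0: "Poly_Mapping.lookup (jet_hom a) 0 = Poly_Mapping.lookup a 0"
proof (induction a rule: poly_mapping_induct)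
  case (single w c)
  have "jet_mon (letters w) = 0 \<longleftrightarrow> w = 0" if "super_degree w = 0"
    using jet_mon_eq_0_iff[of "letters w"] that by (cases w) (simp add: zero_word_def)
  then show ?case
    by (auto simp: jet_hom_single lookup_single when_def super_degree_0)
qed (simp add: jet_hom_add lookup_add)

lemma lookup_jet_mon: "Poly_Mapping.lookup (jet_mon gs) s = count (mset gs) (Ujet s)"
  by (induction gs rule: jet_mon.induct) (simp_all add: lookup_add lookup_single when_def)

lemma even_letters:
  assumes "super_degree (Word gs) = 0" "g \<in> set gs"
  shows "\<not> is_odd_gen g"
  using assms by (auto simp: super_degree_def filter_empty_conv)

text \<open>Even jets are central in the quotient, so the first letter of one word can be pulled to
  the front of the other.\<close>

lemma abs_fmono_mset_cong:
  assumes "super_degree (Word gs) = 0" "mset gs = mset hs"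
  shows "abs_sdiff (fmono gs) = (abs_sdiff (fmono hs) :: 'k::kdv_scalars sdiff)"
  using assms
proof (induction gs arbitrary: hs)
  case (Cons g gs)
  have "g \<in> set hs" using Cons.prems(2) by (metis list.set_intros(1) mset_eq_setD)
  then obtain xs ys where hs: "hs = xs @ g # ys" by (meson split_list)
  have g: "grade (jet g) = (jet g :: 'k sdiff)"
    using even_letters[OF Cons.prems(1), of g] by (simp add: grade_jet)
  have gs: "super_degree (Word gs) = 0"
    using Cons.prems(1) by (simp add: super_degree_def split: if_splits)
  have "(abs_sdiff (fmono hs) :: 'k sdiff) = abs_sdiff (fmono xs) * (jet g * abs_sdiff (fmono ys))"
    by (simp only: hs fmono_append fmono_Cons abs_sdiff_simps jet_def)
  also have "\<dots> = jet g * (abs_sdiff (fmono xs) * abs_sdiff (fmono ys))"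
    by (simp only: mult.assoc[symmetric] even_commute[OF g, of "abs_sdiff (fmono xs)"])
  also have "\<dots> = jet g * abs_sdiff (fmono (xs @ ys))"
    by (simp only: fmono_append abs_sdiff_simps)
  also have "\<dots> = jet g * abs_sdiff (fmono gs)"
    using Cons.IH[OF gs, of "xs @ ys"] Cons.prems(2) hs by simp
  also have "\<dots> = abs_sdiff (fmono (g # gs))"
    by (simp only: fmono_Cons abs_sdiff_simps jet_def)
  finally show ?case by simp
qed simp

definition fbody :: "'k::kdv_scalars freealg \<Rightarrow> 'k freealg" where
  "fbody = Poly_Mapping.mapp (\<lambda>w c. if super_degree w = 0 then c else 0)"

lemma lookup_fbody:
  "Poly_Mapping.lookup (fbody a) w = (if super_degree w = 0 then Poly_Mapping.lookup a w else 0)"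
  by (simp add: fbody_def lookup_mapp when_def in_keys_iff)

lemma fbody_add: "fbody (a + b) = fbody a + fbody b"
  by (rule poly_mapping_eqI) (simp add: lookup_fbody lookup_add)

text \<open>The even jets commute in the quotient, so that the part of super degree 0 can be recovered
  from its image among the commutative jet polynomials.\<close>

lemma fbody_rel_ideal:
  fixes a :: "'k::kdv_scalars freealg"
  assumes "jet_hom a = 0"
  shows "fbody a \<in> rel_ideal"
proof -
  \<comment> \<open>\<open>word_of\<close> chooses one even word for each monomial. Whatever the
    choice, \<open>lift\<close> recovers the part of super degree 0 modulo the ideal from its image
    under \<open>jet_hom\<close>.\<close>
  define word_of where "word_of m = (SOME gs. super_degree (Word gs) = 0 \<and> jet_mon gs = m)" for m
  define lift where
    "lift = linext (\<lambda>m c. scal c * abs_sdiff (fmono (word_of m)) :: 'k sdiff)"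
  have lift_add: "lift (p + q) = lift p + lift q" for p q
    unfolding lift_def by (rule linext_add) (simp add: scal_add distrib_right)
  have lift_single: "lift (Poly_Mapping.single m c) = scal c * abs_sdiff (fmono (word_of m))" for m c
    unfolding lift_def by (rule linext_single) (simp add: scal_add distrib_right)
  have "lift (jet_hom b) = abs_sdiff (fbody b)" for b :: "'k freealg"
  proof (induction b rule: poly_mapping_induct)
    case (single w c)
    show ?case
    proof (cases "super_degree w = 0")
      case True
      define gs where "gs = letters w"
      define hs where "hs = word_of (jet_mon gs)"
      have gs: "super_degree (Word gs) = 0" using True by (simp add: gs_def)
      then have "super_degree (Word hs) = 0 \<and> jet_mon hs = jet_mon gs"
        unfolding hs_def word_of_def by (intro someI_ex[of "\<lambda>hs. super_degree (Word hs) = 0 \<and> jet_mon hs = jet_mon gs"]) auto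
      then have hs: "super_degree (Word hs) = 0" "jet_mon hs = jet_mon gs" by auto
      \<comment> \<open>Without odd letters a word is determined up to order by the exponents of its
        monomial.\<close>
      have "mset gs = mset hs"
      proof (rule multiset_eqI)
        fix g
        show "count (mset gs) g = count (mset hs) g"
        proof (cases g)
          case (Ujet s)
          then show ?thesis using hs(2) by (metis lookup_jet_mon)
        next
          case (Sjet k s)
          then show ?thesis
            using even_letters[OF gs, of g] even_letters[OF hs(1), of g] by (auto simp: count_eq_zero_iff not_in_iff[symmetric])
              (metis count_inI set_mset_mset)
        qed
      qed
      then have "abs_sdiff (fmono gs) = (abs_sdiff (fmono hs) :: 'k sdiff)"
        by (rule abs_fmono_mset_cong[OF gs])
      moreover have "fbody (Poly_Mapping.single w c) = fscal c * fmono gs"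
        unfolding gs_def single_fmono[symmetric]
        by (rule poly_mapping_eqI) (auto simp: lookup_fbody lookup_single when_def True)
      ultimately show ?thesis
        by (simp add: jet_hom_single True lift_single abs_sdiff_simps flip: gs_def hs_def)
    next
      case False
      then have "fbody (Poly_Mapping.single w c) = 0"
        by (intro poly_mapping_eqI) (auto simp: lookup_fbody lookup_single when_def)
      then show ?thesis
        using False by (simp add: jet_hom_single additive_zero[OF lift_add] abs_sdiff_simps)
    qed
  next
    case (add b c)
    then show ?case by (simp add: jet_hom_add fbody_add lift_add abs_sdiff_simps)
  qed
  from this[of a] show ?thesis
    by (simp add: assms additive_zero[OF lift_add] flip: abs_sdiff_eq_0_iff)
qed

text \<open>A representative is split by super degree. The part of degree 0 is handled by
  \<open>jet_dx_kernel\<close>, and the rest is a constant of positive super degree, which the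
  convention on odd constants kills.\<close>

lemma dx_kernel:
  fixes x :: "'k::kdv_scalars sdiff"
  assumes "dx x = 0" "aug x = 0"
  shows "x = 0"
proof -
  obtain a where a: "x = abs_sdiff a"
    using Quotient_abs_rep[OF Quotient_sdiff, of x] by metis
  have fdx: "fdx a \<in> rel_ideal"
    using assms(1) by (simp add: a dx.abs_eq abs_sdiff_eq_0_iff)
  have "jet_hom a = 0"
  proof (rule jet_dx_kernel)
    show "jet_dx (jet_hom a) = 0"
      using jet_hom_rel_ideal[OF fdx] by (simp add: jet_hom_fdx)
    show "Poly_Mapping.lookup (jet_hom a) 0 = 0"
      using assms(2) by (simp add: a aug.abs_eq lookup_jet_hom_0)
  qed
  then have body: "fbody a \<in> rel_ideal" by (rule fbody_rel_ideal)
  have "a - fbody a \<in> rel_ideal"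
  proof (rule rel_ideal.odd_const)
    fix w
    assume "w \<in> Poly_Mapping.keys (a - fbody a)"
    then show "0 < super_degree w"
      by (auto simp: in_keys_iff lookup_minus lookup_fbody split: if_splits)
  next
    show "fdx (a - fbody a) \<in> rel_ideal"
      using fdx rel_ideal.dx[OF body] by (simp add: fdx_diff rel_ideal_diff)
  qed
  from rel_ideal.add[OF this body] show ?thesis
    by (simp add: a abs_sdiff_eq_0_iff)
qed

lemma dx_eqI:
  fixes x y :: "'k::kdv_scalars sdiff"
  assumes "dx x = dx y" "aug x = aug y"
  shows "x = y"
  using dx_kernel[of "x - y"] assms by (simp add: dx_diff aug_diff)


section \<open>Super derivations\<close>

text \<open>An abstract setting with two instances: the differential ring and its enlargement by the
  one-point functions. The two parities are the eigenspaces of \<open>gr\<close>.\<close>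

locale graded_ring =
  fixes par :: "bool \<Rightarrow> 'a::ring_1 set" and gr :: "'a \<Rightarrow> 'a"
  assumes gr_add: "gr (a + b) = gr a + gr b"
    and par_iff: "a \<in> par p \<longleftrightarrow> gr a = (if p then - a else a)"
    and decomp: "\<exists>b\<in>par False. \<exists>c\<in>par True. a = b + c"
begin

lemma gr_even: "a \<in> par False \<Longrightarrow> gr a = a"
  and gr_odd: "a \<in> par True \<Longrightarrow> gr a = - a"
  by (simp_all add: par_iff)

lemma super_derivationI:
  assumes "\<And>a b. D (a + b) = D a + D b" "\<And>c. D (sc c) = 0"
    and "\<And>a. gr (D a) = (if q then - 1 else 1) * D (gr a)"
    and "\<And>a b. D (a * b) = D a * b + (if q then gr a else a) * D b"
  shows "super_derivation par sc q D"
  unfolding super_derivation_def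
  using assms additive_uminus[of D, OF assms(1)] by (auto simp: par_iff)

context
  fixes sc :: "'k \<Rightarrow> 'a" and q :: bool and D :: "'a \<Rightarrow> 'a"
  assumes D: "super_derivation par sc q D"
begin

lemma der_add: "D (a + b) = D a + D b"
  using D by (simp add: super_derivation_def)

lemma der_scal: "D (sc c) = 0"
  using D by (simp add: super_derivation_def)

lemma der_0: "D 0 = 0"
  using der_add by (rule additive_zero)

lemma der_uminus: "D (- a) = - D a"
  using der_add by (rule additive_uminus)

lemma der_diff: "D (a - b) = D a - D b"
  using der_add by (rule additive_diff)

lemma der_par: "a \<in> par p \<Longrightarrow> D a \<in> par (p \<noteq> q)"
  using D by (simp add: super_derivation_def)

lemma der_mult_par: "a \<in> par p \<Longrightarrow> D (a * b) = D a * b + (if p \<and> q then -1 else 1) * a * D b"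
  using D by (simp add: super_derivation_def)

text \<open>Splitting \<open>a\<close> into its even and odd part turns the sign of the Leibniz rule
  into an application of \<open>gr\<close>, for inhomogeneous \<open>a\<close>.\<close>

lemma der_mult: "D (a * b) = D a * b + (if q then gr a else a) * D b"
proof -
  obtain a0 a1 where a: "a0 \<in> par False" "a1 \<in> par True" "a = a0 + a1"
    using decomp by blast
  have "D (a * b) = D (a0 * b) + D (a1 * b)"
    by (simp add: a(3) distrib_right der_add)
  also have "\<dots> = D a * b + (if q then gr a else a) * D b"
    unfolding der_mult_par[OF a(1)] der_mult_par[OF a(2)]
    using gr_even[OF a(1)] gr_odd[OF a(2)] by (simp add: a(3) der_add gr_add algebra_simps)
  finally show ?thesis .
qed

lemma der_gr: "gr (D a) = (if q then - D (gr a) else D (gr a))"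
proof -
  obtain a0 a1 where a: "a0 \<in> par False" "a1 \<in> par True" "a = a0 + a1"
    using decomp by blast
  show ?thesis
    using der_par[OF a(1)] der_par[OF a(2)] gr_even[OF a(1)] gr_odd[OF a(2)]
    by (auto simp: a(3) der_add der_diff gr_add gr_even gr_odd)
qed

end

lemma gr_gr: "gr (gr a) = a"
proof -
  obtain a0 a1 where a: "a0 \<in> par False" "a1 \<in> par True" "a = a0 + a1"
    using decomp by blast
  then show ?thesis
    using gr_even[OF a(1)] gr_odd[OF a(2)] by (simp add: gr_add additive_diff[of gr, OF gr_add])
qed

definition super_comm :: "bool \<Rightarrow> bool \<Rightarrow> ('a \<Rightarrow> 'a) \<Rightarrow> ('a \<Rightarrow> 'a) \<Rightarrow> 'a \<Rightarrow> 'a" where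
  "super_comm q q' D E a = D (E a) - (if q \<and> q' then - E (D a) else E (D a))"

context
  fixes sc :: "'k \<Rightarrow> 'a" and q q' :: bool and D E :: "'a \<Rightarrow> 'a"
  assumes D: "super_derivation par sc q D" and E: "super_derivation par sc q' E"
begin

text \<open>The graded commutator obeys a twisted Leibniz rule again, as a derivation that is odd
  iff exactly one of the two is odd. Hence it vanishes once it vanishes on generators.\<close>

lemma super_comm_mult:
  "super_comm q q' D E (a * b) =
     super_comm q q' D E a * b + (if q = q' then a else gr a) * super_comm q q' D E b"
  unfolding super_comm_def
  by (cases q; cases q')
    (simp_all add: der_mult[OF D] der_mult[OF E] der_add[OF D] der_add[OF E] der_gr[OF D] der_gr[OF E]
      gr_gr algebra_simps)

lemma super_comm_add: "super_comm q q' D E (a + b) = super_comm q q' D E a + super_comm q q' D E b"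
  by (simp add: super_comm_def der_add[OF D] der_add[OF E])

lemma super_comm_scal: "super_comm q q' D E (sc c) = 0"
  by (simp add: super_comm_def der_scal[OF D] der_scal[OF E] der_0[OF D] der_0[OF E])

end

end

interpretation sdiff: graded_ring parity "grade :: 'k::kdv_scalars sdiff \<Rightarrow> 'k sdiff"
proof
  fix a :: "'k sdiff"
  let ?h = "scal (of_real (1/2)) :: 'k sdiff"
  show "\<exists>b\<in>parity False. \<exists>c\<in>parity True. a = b + c"
  proof (intro bexI)
    have "?h * (a + grade a) + ?h * (a - grade a) = ?h * (a + a)"
      by (simp add: algebra_simps)
    then show "a = ?h * (a + grade a) + ?h * (a - grade a)"
      by (simp only: scal_half)
    show "?h * (a + grade a) \<in> parity False" "?h * (a - grade a) \<in> parity True"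
      by (simp_all add: parity_iff grade_mult grade_add grade_diff grade_grade grade_scal algebra_simps)
  qed
qed (rule grade_add parity_iff)+


section \<open>Derivations with prescribed values on the generators\<close>

locale jet_derivation =
  fixes q :: bool and val :: "gen \<Rightarrow> 'k::kdv_scalars sdiff"
  assumes val_next: "val (next_gen g) = dx (val g)"
    and val_grade: "grade (val g) = (if is_odd_gen g = q then val g else - val g)"
    and val_aug: "aug (val g) = 0"
    and val_sigma: "dx (val (Sjet (Suc k) 0)) = P1 (val (Sjet k 0))
      + val (Ujet 0) * dx (\<sigma> k) + scal (of_real (1/2)) * (dx (val (Ujet 0)) * \<sigma> k)"
begin

definition twist :: "'k sdiff \<Rightarrow> 'k sdiff" where
  "twist a = (if q then grade a else a)"

fun word_der :: "gen list \<Rightarrow> 'k sdiff" where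
  "word_der [] = 0"
| "word_der (g # gs) = val g * abs_sdiff (fmono gs) + twist (jet g) * word_der gs"

definition free_der :: "'k freealg \<Rightarrow> 'k sdiff" where
  "free_der = linext (\<lambda>w c. scal c * word_der (letters w))"

lemma twist_simps:
  "twist (a + b) = twist a + twist b" "twist (a * b) = twist a * twist b" "twist 1 = 1"
  "twist (scal c) = scal c" "dx (twist a) = twist (dx a)" "twist 0 = 0" "twist (- a) = - twist a"
  by (simp_all add: twist_def grade_add grade_mult grade_1 grade_scal grade_dx grade_0 grade_uminus)

lemma free_der_add: "free_der (a + b) = free_der a + free_der b"
  unfolding free_der_def by (rule linext_add) (simp add: scal_add distrib_right)

lemma free_der_single: "free_der (Poly_Mapping.single w c) = scal c * word_der (letters w)"
  unfolding free_der_def by (rule linext_single) (simp add: scal_add distrib_right)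

lemma free_der_uminus: "free_der (- a) = - free_der a"
  using free_der_add by (rule additive_uminus)

lemma free_der_diff: "free_der (a - b) = free_der a - free_der b"
  using free_der_add by (rule additive_diff)

lemma abs_fmono_Cons: "abs_sdiff (fmono (g # gs)) = (jet g * abs_sdiff (fmono gs) :: 'k sdiff)"
  by (simp only: fmono_Cons abs_sdiff_simps jet_def)

lemma abs_fmono_append: "abs_sdiff (fmono (gs @ hs)) = (abs_sdiff (fmono gs) * abs_sdiff (fmono hs) :: 'k sdiff)"
  by (simp only: fmono_append abs_sdiff_simps)

lemma abs_fmono_Nil: "abs_sdiff (fmono []) = (1 :: 'k sdiff)"
  by (simp only: fmono_Nil abs_sdiff_simps)

lemma word_der_append:
  "word_der (gs @ hs) = word_der gs * abs_sdiff (fmono hs) + twist (abs_sdiff (fmono gs)) * word_der hs"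
  by (induction gs)
    (simp_all add: abs_fmono_Cons abs_fmono_append abs_fmono_Nil twist_simps distrib_left distrib_right
      mult.assoc add.assoc del: fmono_append)

lemma abs_single: "abs_sdiff (Poly_Mapping.single w c) = (scal c * abs_sdiff (fmono (letters w)) :: 'k sdiff)"
  by (subst single_fmono) (simp only: abs_sdiff_simps)

lemma free_der_mult: "free_der (a * b) = free_der a * abs_sdiff b + twist (abs_sdiff a) * free_der b"
proof (induction a rule: poly_mapping_induct)
  case (single w c)
  show ?case
  proof (induction b rule: poly_mapping_induct)
    case (single w' d)
    have "letters (w + w') = letters w @ letters w'" by (simp add: plus_word_def)
    then have "free_der (Poly_Mapping.single w c * Poly_Mapping.single w' d)
        = scal c * (scal d * (word_der (letters w) * abs_sdiff (fmono (letters w'))))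
        + scal c * (scal d * (twist (abs_sdiff (fmono (letters w))) * word_der (letters w')))"
      by (simp only: mult_single free_der_single word_der_append scal_mult mult.assoc distrib_left)
    also have "\<dots> = free_der (Poly_Mapping.single w c) * abs_sdiff (Poly_Mapping.single w' d)
       + twist (abs_sdiff (Poly_Mapping.single w c)) * free_der (Poly_Mapping.single w' d)"
      unfolding free_der_single abs_single[of w c] abs_single[of w' d] twist_simps mult.assoc
      by (simp only: scal_left_commute[of "word_der (letters w)" d]
          scal_left_commute[of "twist (abs_sdiff (fmono (letters w)))" d])
    finally show ?case .
  qed (simp add: distrib_left free_der_add abs_sdiff_simps)
qed (simp add: distrib_right free_der_add abs_sdiff_simps twist_simps)

lemma free_der_fscal: "free_der (fscal c) = 0"
  by (simp add: fscal_def free_der_single zero_word_def)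

lemma free_der_fgen: "free_der (fgen g) = val g"
  by (simp add: fgen_def free_der_single scal_1 abs_fmono_Nil)

lemma free_der_fdx: "free_der (fdx a) = dx (free_der a)"
  by (induction a rule: freealg_induct)
    (simp_all add: free_der_fscal free_der_fgen fdx_fscal fdx_fgen val_next dx_0 additive_zero[OF free_der_add]
      free_der_add fdx_add dx_add free_der_mult fdx_mult dx_mult abs_sdiff_simps twist_simps algebra_simps)

lemma aug_free_der: "aug (free_der a) = 0"
  by (induction a rule: freealg_induct)
    (simp_all add: free_der_fscal free_der_fgen val_aug free_der_add free_der_mult aug_add aug_mult aug_0)

lemma grade_free_der: "grade (free_der a) = (if q then - 1 else 1) * free_der (fgrade a)"
proof -
  define s :: "'k sdiff" where "s = (if q then - 1 else 1)"
  have s_commute: "x * (s * y) = s * (x * y)" for x y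
    by (simp add: s_def)
  have "free_der (fgrade (fgen g)) = (if is_odd_gen g then - val g else val g)" for g
    by (simp add: fgrade_fgen free_der_fgen free_der_uminus)
  then have s_val: "s * free_der (fgrade (fgen g)) = (if is_odd_gen g = q then val g else - val g)" for g
    by (simp add: s_def)
  have "grade (free_der a) = s * free_der (fgrade a)"
  proof (induction a rule: freealg_induct)
    case (gen g)
    show ?case by (simp only: free_der_fgen val_grade s_val)
  next
    case (mult a b)
    have "grade (twist x) = twist (grade x)" for x by (simp add: twist_def)
    with mult show ?case
      by (simp add: fgrade_mult free_der_mult grade_add grade_mult distrib_left mult.assoc s_commute
          flip: grade.abs_eq)
  qed (simp_all add: fgrade_fscal free_der_fscal grade_0 fgrade_add free_der_add grade_add distrib_left)
  then show ?thesis by (simp only: s_def)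
qed

lemma val_supercommute:
  "val g * jet h = (if is_odd_gen h \<and> is_odd_gen g \<noteq> q then - (jet h * val g) else jet h * val g)"
  using jet_supercommute[of h "val g"] by (auto simp: val_grade)

text \<open>This makes the derivation well defined on the quotient. The commutators vanish by the
  parities of the values, the relations between the odd variables by \<open>val_sigma\<close>. For
  \<open>odd_const\<close> the value has derivative zero and, because of \<open>val_aug\<close>, no
  constant term, so \<open>dx_kernel\<close> applies.\<close>

lemma free_der_rel_ideal: "a \<in> rel_ideal \<Longrightarrow> free_der a = 0"
proof (induction rule: rel_ideal.induct)
  case (mult a b c)
  then show ?case
    by (simp add: free_der_mult abs_sdiff_simps abs_sdiff_eq_0_iff[THEN iffD2] twist_simps)
next
  case (scomm g h)
  have comm: "free_der (fgen g * fgen h) = val g * jet h + twist (jet g) * val h" for g h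
    by (simp add: free_der_mult free_der_fgen jet_def)
  have tw: "twist (jet g) = (if q \<and> is_odd_gen g then - jet g else jet g)" for g
    by (simp add: twist_def grade_jet)
  have expand: "free_der (fgen g * fgen h - (if P then -1 else 1) * (fgen h * fgen g))
      = val g * jet h + twist (jet g) * val h - (if P then -1 else 1) * (val h * jet g + twist (jet h) * val g)" for P
    by (simp add: free_der_diff free_der_add free_der_uminus comm)
  show ?case
    unfolding expand tw val_supercommute[of g h] val_supercommute[of h g] by auto
next
  case (sigma k)
  have u: "twist (abs_sdiff (fgen (Ujet s))) = abs_sdiff (fgen (Ujet s) :: 'k freealg)" for s
    using grade_jet[of "Ujet s", where 'a = 'k] by (simp add: twist_def jet_def)
  have dxu: "jet (Ujet (Suc 0)) = (dx u_var :: 'k sdiff)"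
    using jet_next[of "Ujet 0", where 'a = 'k] by (simp add: jet_u)
  have "free_der (fP1 (fgen (Sjet k 0))) = P1 (val (Sjet k 0))
      + val (Ujet 0) * dx (\<sigma> k) + scal (of_real (1/2)) * (dx (val (Ujet 0)) * \<sigma> k)"
    using val_next[of "Ujet 0"]
    by (simp add: fP1_def P1_def free_der_add free_der_mult free_der_fscal free_der_fgen free_der_fdx
        u abs_sdiff_simps twist_simps distrib_left)
      (simp add: jet_def[symmetric] jet_u jet_sigma dxu)
  then show ?case
    by (simp add: free_der_diff free_der_fdx free_der_fgen val_sigma)
next
  case (odd_const a)
  then show ?case using dx_kernel[of "free_der a"] by (simp add: free_der_fdx aug_free_der)
qed (simp_all add: free_der_add free_der_fdx dx_0 additive_zero[OF free_der_add])

definition der :: "'k sdiff \<Rightarrow> 'k sdiff" where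
  "der x = free_der (rep_sdiff x)"

lemma der_abs: "der (abs_sdiff a) = free_der a"
proof -
  have "abs_sdiff (rep_sdiff (abs_sdiff a)) = abs_sdiff a"
    by (rule Quotient_abs_rep[OF Quotient_sdiff])
  then have "rep_sdiff (abs_sdiff a) - a \<in> rel_ideal"
    by (simp add: abs_sdiff_eq_iff)
  then show ?thesis
    using free_der_rel_ideal by (fastforce simp: der_def free_der_diff)
qed

lemma super_derivation_der: "super_derivation parity scal q der"
proof -
  have add: "der (x + y) = der x + der y" for x y
  proof -
    have "der (abs_sdiff a + abs_sdiff b) = der (abs_sdiff a) + der (abs_sdiff b)" for a b
      by (simp add: plus_sdiff.abs_eq der_abs free_der_add)
    then show ?thesis by (metis Quotient_abs_rep[OF Quotient_sdiff])
  qed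
  have mult: "der (x * y) = der x * y + twist x * der y" for x y
  proof -
    have "der (abs_sdiff a * abs_sdiff b) = der (abs_sdiff a) * abs_sdiff b + twist (abs_sdiff a) * der (abs_sdiff b)" for a b
      by (simp add: times_sdiff.abs_eq der_abs free_der_mult)
    then show ?thesis by (metis Quotient_abs_rep[OF Quotient_sdiff])
  qed
  have scal: "der (scal c) = 0" for c
    by (simp add: scal.abs_eq der_abs free_der_fscal)
  have grade: "grade (der x) = (if q then - 1 else 1) * der (grade x)" for x
  proof -
    have "grade (der (abs_sdiff a)) = (if q then - 1 else 1) * der (grade (abs_sdiff a))" for a
      by (simp add: grade.abs_eq der_abs grade_free_der)
    then show ?thesis by (metis Quotient_abs_rep[OF Quotient_sdiff])
  qed
  show ?thesis
    using add scal grade mult unfolding twist_def by (rule sdiff.super_derivationI)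
qed

lemma der_dx: "der (dx x) = dx (der x)"
proof -
  have "der (dx (abs_sdiff a)) = dx (der (abs_sdiff a))" for a
    by (simp add: dx.abs_eq der_abs free_der_fdx)
  then show ?thesis by (metis Quotient_abs_rep[OF Quotient_sdiff])
qed

lemma der_jet: "der (jet g) = val g"
  by (simp add: jet_def der_abs free_der_fgen)

end

text \<open>The last hypothesis is what results from applying \<open>D\<close> to the relation
  \<open>dx_sigma_Suc\<close>, where \<open>D\<close> replaces \<open>u_var\<close> by
  \<open>U\<close> in the coefficients of \<open>P1\<close>.\<close>

lemma ex_super_derivation:
  fixes U :: "'k::kdv_scalars sdiff" and S :: "nat \<Rightarrow> 'k sdiff"
  assumes "grade U = (if q then - U else U)" "\<And>k. grade (S k) = (if q then S k else - S k)"
    and "aug U = 0" "\<And>k. aug (S k) = 0"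
    and "\<And>k. dx (S (Suc k)) = P1 (S k) + U * dx (\<sigma> k) + scal (of_real (1/2)) * (dx U * \<sigma> k)"
  shows "\<exists>D. super_derivation parity scal q D \<and> (\<forall>a. D (dx a) = dx (D a)) \<and>
    D u_var = U \<and> (\<forall>k. D (\<sigma> k) = S k)"
proof -
  define val where "val g = (case g of Ujet s \<Rightarrow> (dx ^^ s) U | Sjet k s \<Rightarrow> (dx ^^ s) (S k))" for g
  have grade: "grade ((dx ^^ s) a) = (dx ^^ s) (grade a)" for s and a :: "'k sdiff"
    by (induction s) (simp_all add: grade_dx)
  have uminus: "(dx ^^ s) (- a) = - (dx ^^ s) a" for s and a :: "'k sdiff"
    by (induction s) (simp_all add: dx_uminus)
  have aug: "aug ((dx ^^ s) a) = 0" if "aug a = 0" for s and a :: "'k sdiff"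
    using that by (cases s) (simp_all add: aug_dx)
  interpret jet_derivation q val
  proof
    show "val (next_gen g) = dx (val g)" for g
      by (cases g) (simp_all add: val_def)
    show "grade (val g) = (if is_odd_gen g = q then val g else - val g)" for g
      by (cases g) (simp_all add: val_def grade assms uminus)
    show "aug (val g) = 0" for g
      by (cases g) (simp_all add: val_def aug assms)
    show "dx (val (Sjet (Suc k) 0)) = P1 (val (Sjet k 0))
      + val (Ujet 0) * dx (\<sigma> k) + scal (of_real (1/2)) * (dx (val (Ujet 0)) * \<sigma> k)" for k
      by (simp add: val_def assms)
  qed
  show ?thesis
    using super_derivation_der der_dx der_jet[of "Ujet 0"] der_jet[of "Sjet _ 0"]
    by (intro exI[of _ der]) (simp add: jet_u jet_sigma val_def)
qed


section \<open>The Lenard recursion\<close>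

text \<open>With h = u/2 the operator \<open>P1\<close> is 2h d + h' plus the dispersive term, free
  of fractions in h, and h is the first nontrivial term of the rescaled Lenard sequence.\<close>

definition half_u :: "'k::kdv_scalars sdiff" where
  "half_u = scal (of_real (1/2)) * u_var"

lemma half_u_double: "half_u + half_u = u_var"
  using scal_half by (simp add: half_u_def distrib_left)

abbreviation disp :: "'k::kdv_scalars sdiff" where
  "disp \<equiv> scal (of_real (1/8) * \<epsilon>\<^sup>2)"

lemma P1_half_u: "P1 a = half_u * dx a + half_u * dx a + dx half_u * a + disp * dx (dx (dx a))"
proof -
  have "scal (of_real (1/2)) * (dx u_var * a) = dx half_u * a"
    by (simp add: half_u_def dx_mult dx_scal mult.assoc)
  then show ?thesis
    by (simp add: P1_def flip: half_u_double distrib_right)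
qed

lemma grade_half_u: "grade half_u = half_u"
  by (simp add: half_u_def grade_mult grade_scal grade_u)

lemma aug_half_u: "aug half_u = 0"
  by (simp add: half_u_def aug_mult aug_u)

lemma half_u_left_commute:
  "x * (half_u * y) = half_u * (x * y)" "x * (dx half_u * y) = dx half_u * (x * y)"
  "x * (dx (dx half_u) * y) = dx (dx half_u) * (x * y)" "x * (disp * y) = disp * (x * y)"
proof -
  have "x * (c * y) = c * (x * y)" if "grade c = c" for c :: "'a sdiff"
    by (simp only: mult.assoc[symmetric] even_commute[OF that, of x])
  then show "x * (half_u * y) = half_u * (x * y)" "x * (dx half_u * y) = dx half_u * (x * y)"
    "x * (dx (dx half_u) * y) = dx (dx half_u) * (x * y)" "x * (disp * y) = disp * (x * y)"
    by (simp_all add: grade_half_u grade_dx grade_scal)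
qed

lemma P1_add: "P1 (a + b) = P1 a + P1 b"
  by (simp add: P1_half_u dx_add algebra_simps)

lemma P1_0: "P1 0 = 0"
  using P1_add by (rule additive_zero)

lemma P1_uminus: "P1 (- a) = - P1 a"
  using P1_add by (rule additive_uminus)

lemma dx_P1: "dx (P1 a) = P1 (dx a) + dx half_u * dx a + dx half_u * dx a + dx (dx half_u) * a"
  by (simp add: P1_half_u dx_add dx_mult dx_scal algebra_simps)

text \<open>For commuting arguments this is the Lie bracket of the vector fields a d/dx and b d/dx.
  The order of the factors is kept because the arguments may be odd.\<close>

definition brk :: "'k::kdv_scalars sdiff \<Rightarrow> 'k sdiff \<Rightarrow> 'k sdiff" where
  "brk a b = a * dx b - dx a * b"

lemma dx_brk: "dx (brk a b) = a * dx (dx b) - dx (dx a) * b"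
  by (simp add: brk_def dx_diff dx_mult)

text \<open>The term 2 a' z' + a'' z is the variation of \<open>P1 z\<close> when
  \<open>half_u\<close> moves by a'; on the right \<open>half_u\<close> moves by
  \<open>P1 a\<close>. So the bracket carries a variation one step up the recursion. Both sides
  equal a (P1 y)' + 2 a' P1 y. Only even coefficients are moved past other factors, so the identity
  serves even and odd \<open>a\<close> and \<open>y\<close> alike.\<close>

lemma brk_P1:
  assumes z: "dx z = P1 y"
  shows "dx (brk a z) + (dx a * dx z + dx a * dx z + dx (dx a) * z) =
    P1 (brk a y) + (P1 a * dx y + P1 a * dx y + dx (P1 a) * y)"
proof -
  have "dx (brk a z) + (dx a * dx z + dx a * dx z + dx (dx a) * z)
    = a * dx (P1 y) + (dx a * P1 y + dx a * P1 y)"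
    by (simp add: dx_brk z)
  also have "\<dots> = P1 (brk a y) + (P1 a * dx y + P1 a * dx y + dx (P1 a) * y)"
    by (simp add: P1_half_u brk_def dx_add dx_diff dx_mult dx_scal half_u_left_commute mult.assoc
        distrib_left distrib_right left_diff_distrib right_diff_distrib)
  finally show ?thesis .
qed

text \<open>Skew-adjointness of \<open>P1\<close> with an explicit primitive, again in an order of
  factors that serves all parities.\<close>

lemma P1_skew:
  "P1 a * b + a * P1 b = dx (half_u * (a * b) + half_u * (a * b)
     + disp * (dx (dx a) * b - dx a * dx b + a * dx (dx b)))"
  by (simp add: P1_half_u dx_add dx_diff dx_mult dx_scal half_u_left_commute mult.assoc
        distrib_left distrib_right left_diff_distrib right_diff_distrib)

text \<open>By the shift, \<open>f n k\<close> depends only on \<open>n + k\<close> and is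
  symmetric; antisymmetry and the invertibility of 2 do the rest.\<close>

lemma shift_antisymmetric_zero:
  fixes f :: "nat \<Rightarrow> nat \<Rightarrow> 'k::kdv_scalars sdiff"
  assumes shift: "\<And>n k. f (Suc n) k = f n (Suc k)" and anti: "\<And>n k. f n k = - f k n"
  shows "f n k = 0"
proof -
  have *: "f n k = f 0 (n + k)" for n k
    by (induction n arbitrary: k) (simp_all add: shift)
  then have "f n k = f k n" by (metis add.commute)
  then show ?thesis
    by (metis anti sdiff_eq_neg_iff)
qed

locale lenard_sequence =
  fixes r :: "nat \<Rightarrow> 'k::kdv_scalars sdiff"
  assumes r_0: "r 0 = 1"
    and dx_r_Suc: "dx (r (Suc n)) = P1 (r n)"
    and aug_r_Suc: "aug (r (Suc n)) = 0"
    and grade_r: "grade (r n) = r n"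
begin

lemma r_1: "r (Suc 0) = half_u"
  by (rule dx_eqI) (simp_all add: dx_r_Suc r_0 P1_half_u dx_1 dx_0 aug_r_Suc aug_half_u)

text \<open>Up to normalisation, \<open>W \<sigma> n k\<close> and \<open>W r n k\<close> are the
  derivatives of \<open>\<sigma> k\<close> and \<open>r k\<close> along the \<open>n\<close>-th even
  time. One definition covers both, since both sequences obey the same recursion.\<close>

primrec W :: "(nat \<Rightarrow> 'k sdiff) \<Rightarrow> nat \<Rightarrow> nat \<Rightarrow> 'k sdiff" where
  "W y 0 k = dx (y k)"
| "W y (Suc n) k = W y n (Suc k) + brk (r (Suc n)) (y k)"

lemma W_sum: "W y n k = (\<Sum>i=0..n. r (n - i) * dx (y (k + i)) - dx (r (n - i)) * y (k + i))"
proof (induction n arbitrary: k)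
  case (Suc n)
  show ?case
    by (subst sum.atLeast0_atMost_Suc_shift) (simp add: Suc.IH brk_def)
qed (simp add: r_0 dx_1)

lemma aug_W: "aug (W y n k) = 0"
  by (induction n arbitrary: k) (simp_all add: aug_dx aug_add brk_def aug_diff aug_mult aug_r_Suc)

text \<open>The compatibility with the recursion when \<open>half_u\<close> moves by the derivative
  of \<open>r (Suc n)\<close>. For \<open>n = 0\<close> the flow is \<open>dx\<close>, in view of
  \<open>r_1\<close>; each further step is \<open>brk_P1\<close>.\<close>

lemma dx_W:
  assumes y: "\<And>k. dx (y (Suc k)) = P1 (y k)"
  shows "dx (W y n (Suc k)) = P1 (W y n k)
    + (dx (r (Suc n)) * dx (y k) + dx (r (Suc n)) * dx (y k) + dx (dx (r (Suc n))) * y k)"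
proof (induction n arbitrary: k)
  case 0
  show ?case by (simp add: y dx_P1 r_1 add.assoc)
next
  case (Suc n)
  have "dx (W y (Suc n) (Suc k)) = P1 (W y n (Suc k)) + (dx (brk (r (Suc n)) (y (Suc k))) +
      (dx (r (Suc n)) * dx (y (Suc k)) + dx (r (Suc n)) * dx (y (Suc k)) + dx (dx (r (Suc n))) * y (Suc k)))"
    by (simp add: dx_add Suc.IH algebra_simps)
  then show ?case
    unfolding brk_P1[OF y] by (simp add: P1_add dx_r_Suc[of "Suc n"] algebra_simps)
qed

lemmas dx_W_sigma = dx_W[where y = \<sigma>, OF dx_sigma_Suc]

lemma brk_r_antisym: "brk (r m) (r n) = - brk (r n) (r m)"
  using even_commute[of "dx (r m)" "r n"] even_commute[of "dx (r n)" "r m"]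
  by (simp add: brk_def grade_r grade_dx)

text \<open>The difference of the two sides is antisymmetric, and the antisymmetry of the bracket
  makes it invariant under the shift, so \<open>shift_antisymmetric_zero\<close> applies.\<close>

lemma W_r_sym: "W r m (Suc n) = W r n (Suc m)"
proof -
  have "W r m (Suc n) - W r n (Suc m) = 0"
  proof (rule shift_antisymmetric_zero[where f = "\<lambda>m n. W r m (Suc n) - W r n (Suc m)"])
    show "W r (Suc m) (Suc n) - W r n (Suc (Suc m)) = W r m (Suc (Suc n)) - W r (Suc n) (Suc m)" for m n
      using brk_r_antisym[of "Suc m" "Suc n"] by simp
  qed simp
  then show ?thesis by simp
qed

lemma W_r_0: "W r n 0 = 0"
proof (cases n)
  case (Suc m)
  have "W r m (Suc 0) = dx (r (Suc m))"
    using W_r_sym[of m 0] by simp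
  then show ?thesis by (simp add: Suc brk_def r_0 dx_1)
qed (simp add: r_0 dx_1)

text \<open>The source of the odd primitives \<Phi>. Every bracket in \<open>W\<close> is, modulo
  derivatives, a multiple of some r_n' \<sigma>_k, and such a product is itself a
  derivative.\<close>

lemma W_sigma_exact: "\<exists>p. grade p = - p \<and> dx p = W \<sigma> n k"
proof -
  have *: "\<exists>p. grade p = - p \<and> dx p = dx (r n) * \<sigma> k" for n k
  proof (induction n arbitrary: k)
    case 0
    show ?case by (rule exI[of _ 0]) (simp add: r_0 dx_1 dx_0 grade_0)
  next
    case (Suc n)
    obtain p where p: "grade p = - p" "dx p = dx (r n) * \<sigma> (Suc k)"
      using Suc by blast
    let ?a = "r n" and ?b = "\<sigma> k"
    \<comment> \<open>Modulo derivatives, r_(n+1)' \<sigma>_k = (P1 r_n) \<sigma>_k = - r_n (P1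
      \<sigma>_k) = - r_n \<sigma>_(k+1)' = r_n' \<sigma>_(k+1), which lowers \<open>n\<close> until
      r_0' = 0. The witness collects the primitives of these steps.\<close>
    define p' where "p' = p - r n * \<sigma> (Suc k) + (half_u * (?a * ?b) + half_u * (?a * ?b)
     + disp * (dx (dx ?a) * ?b - dx ?a * dx ?b + ?a * dx (dx ?b)))"
    have "grade p' = - p'"
      by (simp add: p'_def grade_add grade_diff grade_mult grade_dx grade_scal grade_half_u grade_r
          grade_sigma p(1) dx_uminus algebra_simps)
    moreover have "dx p' = dx (r (Suc n)) * \<sigma> k"
      unfolding p'_def dx_add[of "_ - _"] P1_skew[symmetric]
      by (simp add: dx_diff dx_mult p(2) dx_r_Suc dx_sigma_Suc)
    ultimately show ?case by blast
  qed
  show ?thesis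
  proof (induction n arbitrary: k)
    case 0
    show ?case by (rule exI[of _ "\<sigma> k"]) (simp add: grade_sigma)
  next
    case (Suc n)
    obtain p where p: "grade p = - p" "dx p = W \<sigma> n (Suc k)"
      using Suc by blast
    obtain p' where p': "grade p' = - p'" "dx p' = dx (r (Suc n)) * \<sigma> k"
      using * by blast
    \<comment> \<open>The bracket of r and \<sigma> is (r \<sigma>)' - 2 r' \<sigma>, which is why
      \<open>p'\<close> is subtracted twice.\<close>
    let ?p = "p + r (Suc n) * \<sigma> k - p' - p'"
    have "grade ?p = - ?p"
      by (simp add: grade_add grade_diff grade_mult grade_r grade_sigma p(1) p'(1))
    moreover have "dx ?p = W \<sigma> (Suc n) k"
      by (simp add: dx_add dx_diff dx_mult p(2) p'(2) brk_def)
    ultimately show ?case by blast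
  qed
qed

lemma grade_W_sigma: "grade (W \<sigma> n k) = - W \<sigma> n k"
  by (induction n arbitrary: k)
    (simp_all add: grade_dx grade_sigma dx_uminus grade_add brk_def grade_diff grade_mult grade_r)

end

text \<open>Twice the prescribed value of the \<open>n\<close>-th odd flow on
  \<open>\<sigma> k\<close>, extended from \<open>k \<le> n\<close> to all pairs by
  antisymmetry.\<close>

definition Z :: "nat \<Rightarrow> nat \<Rightarrow> 'k::kdv_scalars sdiff" where
  "Z n k = (if k \<le> n then (\<Sum>i<n - k. \<sigma> (i + k) * dx (\<sigma> (n - i - 1)))
     else - (\<Sum>i<k - n. \<sigma> (i + n) * dx (\<sigma> (k - i - 1))))"

lemma Z_antisym: "Z n k = - Z k n"
  by (auto simp: Z_def)

lemma sigma_sigma: "dx (\<sigma> n) * \<sigma> k = - (\<sigma> k * dx (\<sigma> n))"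
  by (rule odd_odd_anticommute) (simp_all add: grade_dx grade_sigma dx_uminus)

lemma brk_sigma_sym: "brk (\<sigma> n) (\<sigma> k) = brk (\<sigma> k) (\<sigma> n)"
  by (simp add: brk_def sigma_sigma)

text \<open>For \<open>k < n\<close> the sum on the left has one more term at either end than
  \<open>Z n (Suc k)\<close>, and these two terms form the bracket. The case \<open>n < k\<close> is
  its mirror image, because the bracket of odd elements is symmetric.\<close>

lemma Z_Suc: "Z (Suc n) k = Z n (Suc k) + brk (\<sigma> n) (\<sigma> k)"
proof -
  have below: "Z (Suc n) k = (Z n (Suc k) + brk (\<sigma> n) (\<sigma> k) :: 'a sdiff)" if "k < n" for n k
  proof -
    obtain d where d: "n = Suc (k + d)" using \<open>k < n\<close> by (metis less_imp_Suc_add)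
    have "(Z (Suc n) k :: 'a sdiff) = (\<Sum>i<Suc (Suc d). \<sigma> (i + k) * dx (\<sigma> (n - i)))"
      by (simp add: Z_def d del: sum.lessThan_Suc)
    also have "\<dots> = \<sigma> k * dx (\<sigma> n) + (\<Sum>i<d. \<sigma> (Suc i + k) * dx (\<sigma> (n - Suc i)))
        + \<sigma> n * dx (\<sigma> k)"
      by (subst sum.lessThan_Suc, subst sum.lessThan_Suc_shift) (simp add: d add.commute)
    also have "(\<Sum>i<d. \<sigma> (Suc i + k) * dx (\<sigma> (n - Suc i))) = (Z n (Suc k) :: 'a sdiff)"
      by (simp add: Z_def d)
    finally show ?thesis by (simp add: brk_def sigma_sigma algebra_simps)
  qed
  consider "k < n" | "k = n" | "n < k" by linarith
  then show ?thesis
  proof cases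
    case 2
    then show ?thesis by (simp add: Z_def brk_def sigma_sigma)
  next
    case 3
    have "Z (Suc n) k = (- Z k (Suc n) :: 'a sdiff)" "Z n (Suc k) = (- Z (Suc k) n :: 'a sdiff)" by (rule Z_antisym)+
    then show ?thesis using below[OF 3] by (simp add: brk_sigma_sym[of n k])
  qed (rule below)
qed

lemma aug_sum: "aug (\<Sum>i\<in>A. f i) = (\<Sum>i\<in>A. aug (f i))"
  by (induction A rule: infinite_finite_induct) (simp_all add: aug_0 aug_add)

lemma grade_sum: "grade (\<Sum>i\<in>A. f i) = (\<Sum>i\<in>A. grade (f i))"
  by (induction A rule: infinite_finite_induct) (simp_all add: grade_0 grade_add)

lemma aug_Z: "aug (Z n k) = 0"
  by (simp add: Z_def aug_uminus aug_sum aug_mult aug_dx)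

lemma grade_Z: "grade (Z n k) = Z n k"
  by (simp add: Z_def grade_uminus grade_sum grade_mult grade_dx grade_sigma dx_uminus)

text \<open>The defect \<open>E\<close> of the identity is invariant under the shift by
  \<open>Z_Suc\<close> and \<open>brk_P1\<close>, and it is antisymmetric, so it vanishes.\<close>

lemma dx_Z:
  "dx (Z n (Suc k)) = P1 (Z n k)
    + (dx (\<sigma> n) * dx (\<sigma> k) + dx (\<sigma> n) * dx (\<sigma> k) + dx (dx (\<sigma> n)) * \<sigma> k)"
proof -
  define E :: "nat \<Rightarrow> nat \<Rightarrow> 'a sdiff" where
    "E n k = dx (Z n (Suc k)) - P1 (Z n k)
      - (dx (\<sigma> n) * dx (\<sigma> k) + dx (\<sigma> n) * dx (\<sigma> k) + dx (dx (\<sigma> n)) * \<sigma> k)" for n k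
  have "E n k = 0"
  proof (rule shift_antisymmetric_zero)
    fix n k
    show "E (Suc n) k = E n (Suc k)"
      using brk_P1[OF dx_sigma_Suc, of "\<sigma> n" k]
      by (simp add: E_def Z_Suc dx_add P1_add dx_sigma_Suc[of n] algebra_simps)
    have sigma: "dx (\<sigma> n) * dx (\<sigma> k) = - (dx (\<sigma> k) * dx (\<sigma> n) :: 'a sdiff)"
      "dx (dx (\<sigma> n)) * \<sigma> k = - (\<sigma> k * dx (dx (\<sigma> n)) :: 'a sdiff)"
      "dx (dx (\<sigma> k)) * \<sigma> n = - (\<sigma> n * dx (dx (\<sigma> k)) :: 'a sdiff)"
      by (rule odd_odd_anticommute; simp add: grade_dx grade_sigma dx_uminus)+
    have Z: "(Z k (Suc n) :: 'a sdiff) = - Z n (Suc k) - brk (\<sigma> n) (\<sigma> k)"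
      "Z k n = (- Z n k :: 'a sdiff)"
      using Z_antisym[of k "Suc n", where 'a = 'a] Z_antisym[of k n, where 'a = 'a]
      by (simp_all add: Z_Suc)
    show "E n k = - E k n"
      unfolding E_def Z by (simp add: dx_diff dx_uminus P1_uminus dx_brk sigma)
  qed
  then show ?thesis by (simp add: E_def algebra_simps)
qed


section \<open>Commutativity of the flows\<close>

lemma sdiff_half_u_induct [case_names scal half_u sigma dx add mult]:
  fixes a :: "'k::kdv_scalars sdiff"
  assumes "\<And>c. P (scal c)" and half_u: "P half_u" and "\<And>k. P (\<sigma> k)"
    and "\<And>a. P a \<Longrightarrow> P (dx a)"
    and add: "\<And>a b. P a \<Longrightarrow> P b \<Longrightarrow> P (a + b)"
    and "\<And>a b. P a \<Longrightarrow> P b \<Longrightarrow> P (a * b)"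
  shows "P a"
proof (induction a rule: sdiff_induct)
  case u
  show ?case using add[OF half_u half_u] by (simp add: half_u_double)
qed (use assms in blast)+

lemma aug_super_derivation:
  fixes D :: "'k::kdv_scalars sdiff \<Rightarrow> 'k sdiff"
  assumes D: "super_derivation parity scal q D" and dx: "\<And>a. D (dx a) = dx (D a)"
    and "aug (D half_u) = 0" "\<And>k. aug (D (\<sigma> k)) = 0"
  shows "aug (D a) = 0"
  by (induction a rule: sdiff_half_u_induct)
    (simp_all add: assms sdiff.der_scal[OF D] sdiff.der_add[OF D] sdiff.der_mult[OF D] aug_0 aug_dx aug_add aug_mult)

text \<open>The second summand is the variation of the coefficients of \<open>P1\<close>. These
  coefficients are even, so no sign arises.\<close>

lemma super_derivation_P1:
  assumes D: "super_derivation parity scal q D" and dx: "\<And>a. D (dx a) = dx (D a)"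
  shows "D (P1 a) = P1 (D a) + (D half_u * dx a + D half_u * dx a + dx (D half_u) * a)"
  by (simp add: P1_half_u sdiff.der_add[OF D] sdiff.der_mult[OF D] sdiff.der_scal[OF D] grade_half_u
      grade_dx grade_scal algebra_simps flip: dx)

locale normalised_flows = lenard_sequence r for r :: "nat \<Rightarrow> 'k::kdv_scalars sdiff" +
  fixes \<delta> \<theta> :: "nat \<Rightarrow> 'k sdiff \<Rightarrow> 'k sdiff"
  assumes der_\<delta>: "super_derivation parity scal False (\<delta> n)"
    and der_\<theta>: "super_derivation parity scal True (\<theta> n)"
    and \<delta>_dx: "\<delta> n (dx a) = dx (\<delta> n a)"
    and \<theta>_dx: "\<theta> n (dx a) = dx (\<theta> n a)"
    and \<delta>_half_u: "\<delta> n half_u = dx (r (Suc n))"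
    and \<theta>_half_u: "\<theta> n half_u = dx (\<sigma> n)"
    and \<delta>_sigma: "\<delta> n (\<sigma> k) = W \<sigma> n k"
    and \<theta>_sigma: "\<theta> n (\<sigma> k) = Z n k"
begin

lemma aug_\<delta>: "aug (\<delta> n a) = 0"
  by (rule aug_super_derivation[OF der_\<delta> \<delta>_dx]) (simp_all add: \<delta>_half_u \<delta>_sigma aug_dx aug_W)

lemma aug_\<theta>: "aug (\<theta> n a) = 0"
  by (rule aug_super_derivation[OF der_\<theta> \<theta>_dx]) (simp_all add: \<theta>_half_u \<theta>_sigma aug_dx aug_Z)

lemma \<delta>_1: "\<delta> n 1 = 0" and \<theta>_1: "\<theta> n 1 = 0"
  using sdiff.der_scal[OF der_\<delta>, of n 1] sdiff.der_scal[OF der_\<theta>, of n 1] by (simp_all add: scal_1)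

text \<open>Both sides vanish at \<open>n = 0\<close> and, by \<open>super_derivation_P1\<close> and
  \<open>dx_W\<close> for \<open>y = r\<close>, obey the same recursion, which determines them as
  their constant terms are zero.\<close>

lemma \<delta>_r: "\<delta> m (r n) = W r m n"
proof (induction n)
  case 0
  show ?case by (simp add: r_0 \<delta>_1 W_r_0)
next
  case (Suc n)
  have "dx (\<delta> m (r (Suc n))) = dx (W r m (Suc n))"
    by (simp add: dx_r_Suc super_derivation_P1[OF der_\<delta> \<delta>_dx] Suc.IH \<delta>_half_u dx_W
        flip: \<delta>_dx)
  then show ?case by (rule dx_eqI) (simp add: aug_\<delta> aug_W)
qed

text \<open>The odd flow on the Lenard sequence equals the even flow on the odd variable,
  \<open>\<delta> m (\<sigma> n)\<close>. This links the commutators of the different types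
  below.\<close>

lemma \<theta>_r: "\<theta> n (r (Suc m)) = W \<sigma> m n"
proof (induction m)
  case 0
  show ?case by (simp add: r_1 \<theta>_half_u)
next
  case (Suc m)
  have "dx (\<theta> n (r (Suc (Suc m)))) = P1 (\<theta> n (r (Suc m)))
      + (dx (\<sigma> n) * dx (r (Suc m)) + dx (\<sigma> n) * dx (r (Suc m)) + dx (dx (\<sigma> n)) * r (Suc m))"
    by (simp only: \<theta>_dx[symmetric] dx_r_Suc[of "Suc m"] super_derivation_P1[OF der_\<theta> \<theta>_dx])
      (simp add: \<theta>_half_u \<theta>_dx)
  \<comment> \<open>\<open>dx_W_sigma\<close> contributes r'' \<sigma>, which \<open>dx_brk\<close>
    trades for r \<sigma>''; the even factors commute.\<close>
  also have "\<dots> = dx (W \<sigma> (Suc m) n)"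
    using even_commute[of "r (Suc m)" "dx (dx (\<sigma> n))"] even_commute[of "dx (r (Suc m))" "dx (\<sigma> n)"]
    by (simp add: Suc.IH dx_add dx_W_sigma dx_brk grade_r grade_dx)
  finally show ?case by (rule dx_eqI) (simp add: aug_\<theta> aug_W del: W.simps)
qed

text \<open>\<open>K\<close> is the graded commutator of two of the flows.  If it kills \<open>u\<close>, then it commutes with
  the Lenard recursion, so that it is determined by one initial value of each sequence.\<close>

lemma super_comm_kernel:
  fixes q q' :: bool and D E :: "'k sdiff \<Rightarrow> 'k sdiff"
  defines "K \<equiv> sdiff.super_comm q q' D E"
  assumes D: "super_derivation parity scal q D" and E: "super_derivation parity scal q' E"
    and dx: "\<And>a. D (dx a) = dx (D a)" "\<And>a. E (dx a) = dx (E a)"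
    and aug: "\<And>a. aug (D a) = 0" "\<And>a. aug (E a) = 0"
    and half_u: "K half_u = 0"
  shows "dx (y (Suc n)) = P1 (y n) \<Longrightarrow> K (y n) = 0 \<Longrightarrow> K (y (Suc n)) = 0"
    and "(\<And>k. K (\<sigma> k) = 0) \<Longrightarrow> K a = 0"
proof -
  have K_add: "K (a + b) = K a + K b" for a b
    unfolding K_def by (rule sdiff.super_comm_add[OF D E])
  have K_mult: "K (a * b) = K a * b + (if q = q' then a else grade a) * K b" for a b
    unfolding K_def by (rule sdiff.super_comm_mult[OF D E])
  have K_scal: "K (scal c) = 0" for c
    unfolding K_def by (rule sdiff.super_comm_scal[OF D E])
  have K_dx: "K (dx a) = dx (K a)" for a
    by (simp add: K_def sdiff.super_comm_def dx dx_diff dx_add dx_uminus)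
  have K_P1: "K (P1 a) = P1 (K a)" for a
    by (simp add: P1_half_u K_add K_mult K_dx K_scal half_u grade_half_u grade_dx grade_scal dx_0)
  have aug_K: "aug (K a) = 0" for a
    by (simp add: K_def sdiff.super_comm_def aug_diff aug_add aug_uminus aug)
  show "K (y (Suc n)) = 0" if "dx (y (Suc n)) = P1 (y n)" "K (y n) = 0"
    by (rule dx_kernel) (simp_all add: aug_K that K_P1 P1_0 flip: K_dx)
  show "K a = 0" if "\<And>k. K (\<sigma> k) = 0"
    by (induction a rule: sdiff_half_u_induct) (simp_all add: K_scal half_u that K_dx dx_0 K_add K_mult)
qed

abbreviation "K\<delta>\<delta> m n \<equiv> sdiff.super_comm False False (\<delta> m) (\<delta> n)"
abbreviation "K\<delta>\<theta> m n \<equiv> sdiff.super_comm False True (\<delta> m) (\<theta> n)"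
abbreviation "K\<theta>\<theta> m n \<equiv> sdiff.super_comm True True (\<theta> m) (\<theta> n)"

text \<open>On \<open>half_u\<close> the three commutators are x-derivatives of known identities:
  \<open>W_r_sym\<close> here, then \<open>\<theta>_r\<close> and \<open>Z_antisym\<close>.\<close>

lemma K\<delta>\<delta>_half_u: "K\<delta>\<delta> m n half_u = 0"
  by (simp add: sdiff.super_comm_def \<delta>_half_u \<delta>_dx \<delta>_r W_r_sym[of m n])

lemma K\<delta>\<theta>_half_u: "K\<delta>\<theta> m n half_u = 0"
  by (simp add: sdiff.super_comm_def \<delta>_half_u \<theta>_half_u \<delta>_dx \<theta>_dx \<delta>_sigma \<theta>_r)

lemma K\<theta>\<theta>_half_u: "K\<theta>\<theta> m n half_u = 0"
  using arg_cong[OF Z_antisym[of m n, where 'a = 'k], of dx]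
  by (simp add: sdiff.super_comm_def \<theta>_half_u \<theta>_dx \<theta>_sigma dx_uminus)

lemmas K\<delta>\<delta>_kernel = super_comm_kernel[OF der_\<delta> der_\<delta> \<delta>_dx \<delta>_dx aug_\<delta> aug_\<delta> K\<delta>\<delta>_half_u]
lemmas K\<delta>\<theta>_kernel = super_comm_kernel[OF der_\<delta> der_\<theta> \<delta>_dx \<theta>_dx aug_\<delta> aug_\<theta> K\<delta>\<theta>_half_u]
lemmas K\<theta>\<theta>_kernel = super_comm_kernel[OF der_\<theta> der_\<theta> \<theta>_dx \<theta>_dx aug_\<theta> aug_\<theta> K\<theta>\<theta>_half_u]

text \<open>The Lenard sequence starts at 1, which derivations kill, so this is available before
  anything is known on the odd variables.\<close>

lemma K\<theta>\<theta>_r: "K\<theta>\<theta> m n (r j) = 0"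
proof (induction j)
  case 0
  show ?case by (simp add: r_0 sdiff.super_comm_def \<theta>_1 sdiff.der_0[OF der_\<theta>])
next
  case (Suc j)
  then show ?case by (rule K\<theta>\<theta>_kernel(1)[where y = r, OF dx_r_Suc])
qed

text \<open>The value is antisymmetric in \<open>n\<close> and \<open>k\<close>: one half of it is
  \<delta>_m of \<open>Z n k\<close>, the other is \<theta>_n \<theta>_k r_(m+1), antisymmetric by
  \<open>K\<theta>\<theta>_r\<close>. So it vanishes at (0, 0), by recursion at (0, k), by
  antisymmetry at (n, 0), and by recursion everywhere.\<close>

lemma K\<delta>\<theta>_sigma: "K\<delta>\<theta> m n (\<sigma> k) = 0"
proof -
  have anti: "K\<delta>\<theta> m n (\<sigma> k) = - K\<delta>\<theta> m k (\<sigma> n)" for n k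
  proof -
    have "\<theta> n (\<theta> k (r (Suc m))) = - \<theta> k (\<theta> n (r (Suc m)))"
      using K\<theta>\<theta>_r[of n k "Suc m"] by (simp add: sdiff.super_comm_def eq_neg_iff_add_eq_0)
    moreover have "\<delta> m (Z n k) = - \<delta> m (Z k n)"
      by (subst Z_antisym) (rule sdiff.der_uminus[OF der_\<delta>])
    ultimately show ?thesis
      by (simp add: sdiff.super_comm_def \<delta>_sigma \<theta>_sigma \<theta>_r)
  qed
  have step: "K\<delta>\<theta> m n (\<sigma> (Suc k)) = 0" if "K\<delta>\<theta> m n (\<sigma> k) = 0" for n k
    using K\<delta>\<theta>_kernel(1)[where y = \<sigma>, OF dx_sigma_Suc that] .
  have 0: "K\<delta>\<theta> m 0 (\<sigma> k) = 0" for k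
    by (induction k) (use anti[of 0 0] step in \<open>simp_all add: sdiff_eq_neg_iff\<close>)
  show ?thesis
    by (induction k) (use anti[of n 0] 0 step in simp_all)
qed

lemma K\<delta>\<theta>_0: "K\<delta>\<theta> m n a = 0"
  by (rule K\<delta>\<theta>_kernel(2)) (rule K\<delta>\<theta>_sigma)

text \<open>Since \<delta>_n \<sigma>_k = \<theta>_k r_(n+1) and \<theta>_k commutes with
  \<delta>_m, the claim on the odd variables is \<theta>_k applied to
  \<open>W_r_sym\<close>.\<close>

lemma K\<delta>\<delta>_0: "K\<delta>\<delta> m n a = 0"
proof (rule K\<delta>\<delta>_kernel(2))
  fix k
  have comm: "\<delta> m (\<theta> k b) = \<theta> k (\<delta> m b)" for m b
    using K\<delta>\<theta>_0[of m k b] by (simp add: sdiff.super_comm_def)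
  have "\<delta> m (\<delta> n (\<sigma> k)) = \<theta> k (W r m (Suc n))" for m n
    by (simp only: \<delta>_sigma \<theta>_r[symmetric] comm \<delta>_r)
  then show "K\<delta>\<delta> m n (\<sigma> k) = 0"
    by (simp add: sdiff.super_comm_def W_r_sym[of m n])
qed

text \<open>Antisymmetry of \<open>Z\<close> makes the cyclic sum over the three indices vanish. The
  recursion lowers a positive \<open>j\<close>; for \<open>j = 0\<close> the cyclic identity refers
  to terms with a positive last index.\<close>

lemma K\<theta>\<theta>_sigma: "n + k + j = N \<Longrightarrow> K\<theta>\<theta> n k (\<sigma> j) = 0"
proof (induction N arbitrary: n k j)
  have sym: "K\<theta>\<theta> n k a = K\<theta>\<theta> k n a" for n k a
    by (simp add: sdiff.super_comm_def add.commute)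
  have cyclic: "K\<theta>\<theta> n k (\<sigma> j) + K\<theta>\<theta> k j (\<sigma> n) + K\<theta>\<theta> j n (\<sigma> k) = 0" for n k j
  proof -
    have "\<theta> l (Z a b) = - \<theta> l (Z b a)" for l a b
      by (subst Z_antisym) (rule sdiff.der_uminus[OF der_\<theta>])
    from this[of n k j] this[of k n j] this[of j n k] show ?thesis
      by (simp add: sdiff.super_comm_def \<theta>_sigma)
  qed
  {
    case 0
    have "K\<theta>\<theta> 0 0 (\<sigma> 0) = 0"
    proof -
      let ?a = "K\<theta>\<theta> 0 0 (\<sigma> 0)"
      \<comment> \<open>With all indices 0 the cyclic identity reads 3 K = 0.\<close>
      have "of_real (1/3) + of_real (1/3) + of_real (1/3) = (1 :: 'k)"
        by (simp flip: of_real_add)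
      then have "?a = (scal (of_real (1/3)) + scal (of_real (1/3)) + scal (of_real (1/3))) * ?a"
        by (simp only: scal_1 flip: scal_add) simp
      also have "\<dots> = scal (of_real (1/3)) * (?a + ?a + ?a)"
        by (simp only: distrib_left distrib_right)
      also have "\<dots> = 0" by (simp only: cyclic mult_zero_right)
      finally show ?thesis .
    qed
    then show ?case using 0 by simp
  next
    case (Suc N)
    have pos: "K\<theta>\<theta> n k (\<sigma> j) = 0" if "n + k + j = Suc N" "0 < j" for n k j
      using that Suc.IH K\<theta>\<theta>_kernel(1)[where y = \<sigma>, OF dx_sigma_Suc] by (cases j) auto
    show ?case
    proof (cases j)
      case 0
      \<comment> \<open>With one positive index, two of the three cyclic terms coincide by
        \<open>sym\<close> and 2 K = 0 remains.\<close>
      consider "0 < n" "0 < k" | "n = 0" "0 < k" | "0 < n" "k = 0" using Suc.prems 0 by auto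
      then show ?thesis
      proof cases
        case 1
        then show ?thesis using pos[of k 0 n] pos[of 0 n k] cyclic[of n k 0] Suc.prems 0 by (simp add: add.commute)
      next
        case 2
        then show ?thesis
          using pos[of 0 0 k] cyclic[of 0 k 0] sym[of 0 k "\<sigma> 0"] Suc.prems 0
          by (simp add: sdiff_double_eq_0_iff)
      next
        case 3
        then show ?thesis
          using pos[of 0 0 n] cyclic[of n 0 0] sym[of 0 n "\<sigma> 0"] Suc.prems 0
          by (simp add: sdiff_double_eq_0_iff)
      qed
    qed (use pos Suc.prems in simp)
  }
qed

lemma K\<theta>\<theta>_0: "K\<theta>\<theta> m n a = 0"
  by (rule K\<theta>\<theta>_kernel(2)) (rule K\<theta>\<theta>_sigma[OF refl])

lemma flows_commute: "mutually_commute \<delta> \<theta>"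
  using K\<delta>\<delta>_0 K\<delta>\<theta>_0 K\<theta>\<theta>_0
  by (simp add: mutually_commute_def sdiff.super_comm_def eq_neg_iff_add_eq_0)

end

section \<open>Existence of the normalised flows\<close>

lemma (in lenard_sequence) ex_normalised_flows: "\<exists>\<delta> \<theta>. normalised_flows r \<delta> \<theta>"
proof -
  \<comment> \<open>Translates the condition of \<open>ex_super_derivation\<close>, expressed by the
    value \<open>u\<close> on \<open>u_var\<close>, into one on its half \<open>U\<close>.\<close>
  have compat: "U + U = u \<Longrightarrow> u * dx s + scal (of_real (1/2)) * (dx u * s) = U * dx s + U * dx s + dx U * s"
    for U u s :: "'k sdiff"
    using scal_half[of "dx U * s"] by (auto simp: dx_add distrib_right)
  have half: "scal (of_real (1/2)) * U = x" if "U = x + x" for U x :: "'k sdiff"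
    using that by (simp only: scal_half)
  have "\<exists>D. super_derivation parity scal False D \<and> (\<forall>a. D (dx a) = dx (D a)) \<and>
      D u_var = dx (r (Suc n)) + dx (r (Suc n)) \<and> (\<forall>k. D (\<sigma> k) = W \<sigma> n k)" for n
  proof (rule ex_super_derivation)
    fix k
    show "dx (W \<sigma> n (Suc k)) = P1 (W \<sigma> n k) + (dx (r (Suc n)) + dx (r (Suc n))) * dx (\<sigma> k)
        + scal (of_real (1/2)) * (dx (dx (r (Suc n)) + dx (r (Suc n))) * \<sigma> k)"
      unfolding dx_W_sigma add.assoc compat[OF refl, unfolded add.assoc] by simp
  qed (auto simp: grade_add grade_dx grade_r grade_W_sigma aug_add aug_dx aug_W)
  then obtain \<delta> where \<delta>: "\<And>n. super_derivation parity scal False (\<delta> n)" "\<And>n a. \<delta> n (dx a) = dx (\<delta> n a)"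
    "\<And>n. \<delta> n u_var = dx (r (Suc n)) + dx (r (Suc n))" "\<And>n k. \<delta> n (\<sigma> k) = W \<sigma> n k"
    by metis
  have "\<exists>D. super_derivation parity scal True D \<and> (\<forall>a. D (dx a) = dx (D a)) \<and>
      D u_var = dx (\<sigma> n) + dx (\<sigma> n) \<and> (\<forall>k. D (\<sigma> k) = (Z n k :: 'k sdiff))" for n
  proof (rule ex_super_derivation)
    fix k
    show "dx (Z n (Suc k)) = P1 (Z n k) + (dx (\<sigma> n) + dx (\<sigma> n)) * dx (\<sigma> k)
        + scal (of_real (1/2)) * (dx (dx (\<sigma> n) + dx (\<sigma> n)) * \<sigma> k :: 'k sdiff)"
      unfolding dx_Z add.assoc compat[OF refl, unfolded add.assoc] by simp
  qed (auto simp: grade_add grade_dx grade_sigma dx_uminus grade_Z aug_add aug_dx aug_Z)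
  then obtain \<theta> where \<theta>: "\<And>n. super_derivation parity scal True (\<theta> n)" "\<And>n a. \<theta> n (dx a) = dx (\<theta> n a)"
    "\<And>n. \<theta> n u_var = dx (\<sigma> n) + dx (\<sigma> n)" "\<And>n k. \<theta> n (\<sigma> k) = (Z n k :: 'k sdiff)"
    by metis
  have "normalised_flows r \<delta> \<theta>"
  proof unfold_locales
    show "\<delta> n half_u = dx (r (Suc n))" for n
      unfolding half_u_def by (simp add: sdiff.der_mult[OF \<delta>(1)] sdiff.der_scal[OF \<delta>(1)] \<delta>(3) scal_half)
    show "\<theta> n half_u = dx (\<sigma> n)" for n
      unfolding half_u_def by (simp add: sdiff.der_mult[OF \<theta>(1)] sdiff.der_scal[OF \<theta>(1)] \<theta>(3) scal_half grade_scal)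
  qed (simp_all add: \<delta> \<theta>)
  then show ?thesis by blast
qed


section \<open>Passing between the original and the rescaled normalisation\<close>

abbreviation rscal :: "real \<Rightarrow> 'k::kdv_scalars sdiff" where
  "rscal x \<equiv> scal (of_real x)"

lemma rscal_rscal: "rscal x * (rscal y * a) = rscal (x * y) * a"
  by (simp add: scal_mult mult.assoc)

lemma rscal_cancel:
  assumes "x \<noteq> 0"
  shows "rscal x * a = rscal x * b \<longleftrightarrow> a = (b :: 'k::kdv_scalars sdiff)"
proof
  assume "rscal x * a = rscal x * b"
  then have "rscal (1 / x) * (rscal x * a) = rscal (1 / x) * (rscal x * b)"
    by simp
  then show "a = b"
    unfolding rscal_rscal using assms by (simp add: scal_1)
qed simp

lemma dx_rscal: "dx (rscal x * a) = rscal x * dx a"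
  by (simp add: dx_mult dx_scal)

lemma P1_rscal: "P1 (rscal x * a) = rscal x * P1 a"
  by (simp add: P1_half_u dx_rscal distrib_left scal_left_commute[of half_u]
      scal_left_commute[of "dx half_u"] scal_left_commute[of disp "of_real x"])

lemma der_rscal:
  assumes "super_derivation parity scal q D"
  shows "D (rscal x * a) = rscal x * D a"
  by (simp add: sdiff.der_mult[OF assms] sdiff.der_scal[OF assms] grade_scal)

lemma super_derivation_rscal:
  assumes D: "super_derivation parity scal q D"
  shows "super_derivation parity scal q (\<lambda>a. rscal x * D a)"
proof (rule sdiff.super_derivationI)
  show "grade (rscal x * D a) = (if q then - 1 else 1) * (rscal x * D (grade a))" for a
    by (simp add: grade_mult grade_scal sdiff.der_gr[OF D])
  show "rscal x * D (a * b) = rscal x * D a * b + (if q then grade a else a) * (rscal x * D b)" for a b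
    by (simp only: sdiff.der_mult[OF D] scal_left_commute[of "if q then grade a else a"] distrib_left mult.assoc)
qed (simp_all add: sdiff.der_add[OF D] sdiff.der_scal[OF D] distrib_left)

lemma upolys0_grade: "a \<in> upolys0 \<Longrightarrow> grade a = a"
proof -
  assume "a \<in> upolys0"
  then have "a \<in> parity False" by (auto simp: upolys0_def parity_def)
  then show ?thesis by (simp add: parity_iff)
qed

lemma upolys0_aug: "a \<in> upolys0 \<Longrightarrow> aug a = 0"
  by (auto simp: upolys0_def aug.abs_eq in_keys_iff)

text \<open>The product of the numbers j + 1/2 for \<open>j < n\<close>, which absorbs the factors
  of the Lenard recursion.\<close>

definition gamma_ratio :: "nat \<Rightarrow> real" where
  "gamma_ratio n = Gamma (real n + 1/2) / Gamma (1/2)"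

lemma gamma_ratio_0: "gamma_ratio 0 = 1"
  by (simp add: gamma_ratio_def Gamma_one_half_real)

lemma gamma_ratio_Suc: "gamma_ratio (Suc n) = gamma_ratio n * (real n + 1/2)"
proof -
  have "real n + 1/2 \<notin> \<int>\<^sub>\<le>\<^sub>0"
    by (auto elim!: nonpos_Ints_cases)
  then have "Gamma (real n + 1/2 + 1) = (real n + 1/2) * Gamma (real n + 1/2)"
    by (rule Gamma_plus1)
  then show ?thesis by (simp add: gamma_ratio_def algebra_simps)
qed

lemma gamma_ratio_pos: "gamma_ratio n > 0"
  by (induction n) (simp_all add: gamma_ratio_0 gamma_ratio_Suc)

definition normalised :: "(nat \<Rightarrow> 'k::kdv_scalars sdiff) \<Rightarrow> nat \<Rightarrow> 'k sdiff" where
  "normalised R n = rscal (gamma_ratio n) * R n"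

lemma normalised_inverse: "R n = rscal (1 / gamma_ratio n) * normalised R n"
  using gamma_ratio_pos[of n] by (simp add: normalised_def rscal_rscal scal_1)

lemma lenard_sequence_normalised:
  fixes R :: "nat \<Rightarrow> 'k::kdv_scalars sdiff"
  assumes R: "lenard R"
  shows "lenard_sequence (normalised R)"
proof
  have R0: "R 0 = 1" and RSuc: "R (Suc n) \<in> upolys0"
    and rec: "rscal (real n + 1/2) * dx (R (Suc n)) = P1 (R n)" for n
    using R by (simp_all add: lenard_def)
  show "normalised R 0 = 1"
    by (simp add: normalised_def gamma_ratio_0 scal_1 R0)
  show "dx (normalised R (Suc n)) = P1 (normalised R n)" for n
    unfolding normalised_def dx_rscal P1_rscal rec[symmetric] rscal_rscal gamma_ratio_Suc ..
  show "aug (normalised R (Suc n)) = 0" for n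
    by (simp add: normalised_def aug_mult upolys0_aug RSuc)
  show "grade (normalised R n) = normalised R n" for n
    by (cases n) (simp_all add: normalised_def grade_mult grade_scal R0 grade_1 upolys0_grade RSuc)
qed

lemma t_sigma_W:
  fixes R :: "nat \<Rightarrow> 'k::kdv_scalars sdiff"
  assumes "lenard R"
  shows "t_sigma R n k = rscal (1 / (2 * gamma_ratio (Suc n))) * lenard_sequence.W (normalised R) \<sigma> n k"
proof -
  interpret lenard_sequence "normalised R" using assms by (rule lenard_sequence_normalised)
  let ?r = "normalised R"
  have summand: "rscal (Gamma (real n + 1/2 - real i) / Gamma (real n + 3/2)) *
        (R (n - i) * dx (\<sigma> (k + i)) - dx (R (n - i)) * \<sigma> (k + i))
      = rscal (1 / gamma_ratio (Suc n)) * (?r (n - i) * dx (\<sigma> (k + i)) - dx (?r (n - i)) * \<sigma> (k + i))"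
    if "i \<le> n" for i
  proof -
    \<comment> \<open>The numerator is absorbed into the rescaled term with index
      \<open>n - i\<close>; the denominator does not depend on \<open>i\<close> and leaves the
      sum.\<close>
    have "Gamma (real n + 1/2 - real i) / Gamma (real n + 3/2) = gamma_ratio (n - i) / gamma_ratio (Suc n)"
      using that by (simp add: gamma_ratio_def of_nat_diff algebra_simps Gamma_one_half_real)
    then have "rscal (Gamma (real n + 1/2 - real i) / Gamma (real n + 3/2)) * a
        = rscal (1 / gamma_ratio (Suc n)) * (rscal (gamma_ratio (n - i)) * a)" for a :: "'k sdiff"
      by (simp add: rscal_rscal)
    then show ?thesis
      by (simp add: normalised_def dx_rscal right_diff_distrib mult.assoc)
  qed
  have "t_sigma R n k = rscal (1/2) * (\<Sum>i=0..n. rscal (1 / gamma_ratio (Suc n)) *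
      (?r (n - i) * dx (\<sigma> (k + i)) - dx (?r (n - i)) * \<sigma> (k + i)))"
    unfolding t_sigma_def by (intro arg_cong[of _ _ "(*) _"] sum.cong refl) (simp only: summand atLeastAtMost_iff)
  then show ?thesis
    by (simp add: W_sum rscal_rscal flip: sum_distrib_left)
qed

lemma tau_sigma_Z: "k \<le> n \<Longrightarrow> tau_sigma n k = rscal (1/2) * Z n k"
  by (simp add: tau_sigma_def Z_def)

text \<open>The factor 2 comes from prescribing the values on \<open>half_u\<close> instead of
  \<open>u_var\<close>, and the Gamma ratio rescales \<open>R (Suc n)\<close>.\<close>

lemma normalised_flowsI:
  fixes R :: "nat \<Rightarrow> 'k::kdv_scalars sdiff"
  assumes R: "lenard R" and flows: "super_kdv_flows R t \<tau>"
  shows "normalised_flows (normalised R)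
     (\<lambda>n a. rscal (2 * gamma_ratio (Suc n)) * t n a) (\<lambda>n a. rscal 2 * \<tau> n a)"
proof -
  interpret lenard_sequence "normalised R" using R by (rule lenard_sequence_normalised)
  have t: "super_derivation parity scal False (t n)" "t n (dx a) = dx (t n a)"
    "t n u_var = dx (R (Suc n))" "t n (\<sigma> k) = t_sigma R n k"
    and \<tau>: "super_derivation parity scal True (\<tau> n)" "\<tau> n (dx a) = dx (\<tau> n a)"
    "\<tau> n u_var = dx (\<sigma> n)"
    and \<tau>_sigma: "k \<le> n \<Longrightarrow> \<tau> n (\<sigma> k) = tau_sigma n k \<and> \<tau> k (\<sigma> n) = - tau_sigma n k" for n k a
    using flows by (auto simp: super_kdv_flows_def)
  note pos = gamma_ratio_pos[of "Suc n" for n]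
  show ?thesis
  proof unfold_locales
    show "rscal (2 * gamma_ratio (Suc n)) * t n half_u = dx (normalised R (Suc n))" for n
      unfolding half_u_def der_rscal[OF t(1)] rscal_rscal t(3) normalised_def dx_rscal by simp
    show "rscal 2 * \<tau> n half_u = dx (\<sigma> n)" for n
      unfolding half_u_def der_rscal[OF \<tau>(1)] rscal_rscal \<tau>(3) by (simp add: scal_1)
    show "rscal (2 * gamma_ratio (Suc n)) * t n (\<sigma> k) = W \<sigma> n k" for n k
      using pos[of n] unfolding t(4) t_sigma_W[OF R] rscal_rscal by (simp add: scal_1)
    show "rscal 2 * \<tau> n (\<sigma> k) = Z n k" for n k
    proof (cases "k \<le> n")
      case True
      then show ?thesis
        using \<tau>_sigma[OF True] unfolding tau_sigma_Z[OF True] by (simp only: rscal_rscal) (simp add: scal_1)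
    next
      case False
      then have kn: "n \<le> k" by simp
      have "rscal 2 * \<tau> n (\<sigma> k) = - (rscal 2 * (rscal (1/2) * Z k n))"
        using \<tau>_sigma[OF kn] unfolding tau_sigma_Z[OF kn] by (simp only: mult_minus_right)
      then show ?thesis
        unfolding rscal_rscal using Z_antisym[of n k, where 'a = 'k] by (simp add: scal_1)
    qed
  qed (simp_all only: super_derivation_rscal t(1) \<tau>(1) t(2) \<tau>(2) dx_rscal)
qed

lemma ex_super_kdv_flows:
  fixes R :: "nat \<Rightarrow> 'k::kdv_scalars sdiff"
  assumes R: "lenard R"
  shows "\<exists>t \<tau>. super_kdv_flows R t \<tau>"
proof -
  obtain \<delta> \<theta> where "normalised_flows (normalised R) \<delta> \<theta>"
    using lenard_sequence.ex_normalised_flows[OF lenard_sequence_normalised[OF R]] by blast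
  then interpret normalised_flows "normalised R" \<delta> \<theta> .
  define t where "t n a = rscal (1 / (2 * gamma_ratio (Suc n))) * \<delta> n a" for n a
  define \<tau> where "\<tau> n a = rscal (1/2) * \<theta> n a" for n a
  have u: "D u_var = D half_u + D half_u" if "super_derivation parity scal q D" for q D
    by (simp add: half_u_double flip: sdiff.der_add[OF that])
  have "super_kdv_flows R t \<tau>"
    unfolding super_kdv_flows_def
  proof (intro conjI allI impI)
    show "super_derivation parity scal False (t n)" "super_derivation parity scal True (\<tau> n)" for n
      unfolding t_def \<tau>_def by (intro super_derivation_rscal der_\<delta> der_\<theta>)+
    show "t n (dx a) = dx (t n a)" "\<tau> n (dx a) = dx (\<tau> n a)" for n a
      by (simp_all only: t_def \<tau>_def dx_rscal \<delta>_dx \<theta>_dx)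
    show "t n u_var = dx (R (Suc n))" for n
    proof -
      have "dx (R (Suc n)) = rscal (1 / gamma_ratio (Suc n)) * dx (normalised R (Suc n))"
        by (subst normalised_inverse) (rule dx_rscal)
      moreover have "t n u_var = rscal (1 / gamma_ratio (Suc n)) * (rscal (1/2) *
          (dx (normalised R (Suc n)) + dx (normalised R (Suc n))))"
        unfolding t_def u[OF der_\<delta>] \<delta>_half_u rscal_rscal by (simp add: mult.commute)
      ultimately show ?thesis by (simp only: scal_half)
    qed
    show "\<tau> n u_var = dx (\<sigma> n)" for n
      unfolding \<tau>_def u[OF der_\<theta>] \<theta>_half_u by (rule scal_half)
    show "t n (\<sigma> k) = t_sigma R n k" for n k
      by (simp only: t_def \<delta>_sigma t_sigma_W[OF R])
    show "\<tau> n (\<sigma> k) = tau_sigma n k" "\<tau> k (\<sigma> n) = - tau_sigma n k" if "k \<le> n" for n k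
      using Z_antisym[of k n, where 'a = 'k] by (simp_all add: \<tau>_def \<theta>_sigma tau_sigma_Z[OF that])
  qed
  then show ?thesis by blast
qed

section \<open>The original flows: commutativity and odd primitives\<close>

context
  fixes R :: "nat \<Rightarrow> 'k::kdv_scalars sdiff" and t \<tau>
  assumes R: "lenard R" and flows: "super_kdv_flows R t \<tau>"
begin

interpretation normalised_flows "normalised R"
  "\<lambda>n a. rscal (2 * gamma_ratio (Suc n)) * t n a" "\<lambda>n a. rscal 2 * \<tau> n a"
  using R flows by (rule normalised_flowsI)

lemma der_t: "super_derivation parity scal False (t n)"
  and der_\<tau>: "super_derivation parity scal True (\<tau> n)"
  and t_dx: "t n (dx a) = dx (t n a)" and \<tau>_dx: "\<tau> n (dx a) = dx (\<tau> n a)"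
  using flows by (simp_all add: super_kdv_flows_def)

lemma aug_t: "aug (t n a) = 0"
proof -
  have "t n a = rscal (1 / (2 * gamma_ratio (Suc n))) * (rscal (2 * gamma_ratio (Suc n)) * t n a)"
    using gamma_ratio_pos[of "Suc n"] unfolding rscal_rscal by (simp add: scal_1)
  then show ?thesis by (metis aug_\<delta> aug_mult mult_zero_right)
qed

lemma aug_\<tau>: "aug (\<tau> n a) = 0"
proof -
  have "\<tau> n a = rscal (1 / 2) * (rscal 2 * \<tau> n a)"
    unfolding rscal_rscal by (simp add: scal_1)
  then show ?thesis by (metis aug_\<theta> aug_mult mult_zero_right)
qed

lemma flows_mutually_commute: "mutually_commute t \<tau>"
proof -
  let ?c = "\<lambda>n. 2 * gamma_ratio (Suc n)"
  have comm: "rscal (?c m) * t m (rscal (?c n) * t n a) = rscal (?c n) * t n (rscal (?c m) * t m a)"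
    "rscal (?c m) * t m (rscal 2 * \<tau> n a) = rscal 2 * \<tau> n (rscal (?c m) * t m a)"
    "rscal 2 * \<tau> m (rscal 2 * \<tau> n a) = - (rscal 2 * \<tau> n (rscal 2 * \<tau> m a))" for m n a
    using flows_commute unfolding mutually_commute_def by blast+
  have pos: "?c m * ?c n \<noteq> 0" "?c m * 2 \<noteq> 0" "2 * 2 \<noteq> (0 :: real)" for m n
    using gamma_ratio_pos[of "Suc m"] gamma_ratio_pos[of "Suc n"] by simp_all
  note comm' = comm[unfolded der_rscal[OF der_t] der_rscal[OF der_\<tau>] rscal_rscal]
  have "t m (t n a) = t n (t m a)" for m n a
    using comm'(1)[of m n a] unfolding mult.commute[of "?c n" "?c m"] rscal_cancel[OF pos(1)] .
  moreover have "t m (\<tau> n a) = \<tau> n (t m a)" for m n a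
    using comm'(2)[of m n a] unfolding mult.commute[of 2 "?c m"] rscal_cancel[OF pos(2)] .
  moreover have "\<tau> m (\<tau> n a) = - \<tau> n (\<tau> m a)" for m n a
    using comm'(3)[of m n a] unfolding mult_minus_right[symmetric] rscal_cancel[OF pos(3)] .
  ultimately show ?thesis
    unfolding mutually_commute_def by blast
qed

text \<open>By \<open>\<theta>_r\<close> the odd flow on \<open>R (Suc k)\<close> is a multiple of
  \<open>W \<sigma> k n\<close>, of which \<open>W_sigma_exact\<close> provides an odd
  primitive.\<close>

lemma ex_super_two_point: "\<exists>\<phi>. super_two_point R \<tau> k n \<phi>"
proof -
  obtain p where p: "grade p = - p" "dx p = W \<sigma> k n"
    using W_sigma_exact by blast
  let ?p = "rscal (1 / (2 * gamma_ratio (Suc k))) * p"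
  have "\<tau> n (R (Suc k)) = rscal (1 / gamma_ratio (Suc k)) * \<tau> n (normalised R (Suc k))"
    by (subst normalised_inverse) (rule der_rscal[OF der_\<tau>])
  also have "\<dots> = rscal (1 / (2 * gamma_ratio (Suc k))) * (rscal 2 * \<tau> n (normalised R (Suc k)))"
    unfolding rscal_rscal by simp
  also have "\<dots> = dx ?p"
    by (simp only: \<theta>_r dx_rscal p(2))
  finally have "\<tau> n (R (Suc k)) = dx ?p" .
  moreover have "?p \<in> parity True"
    by (simp add: parity_iff grade_mult grade_scal p(1))
  ultimately show ?thesis
    unfolding super_two_point_def by blast
qed

end


section \<open>The tau cover\<close>

lemma poly_map_mult:
  fixes f :: "'a::semiring_0 \<Rightarrow> 'a"
  assumes add: "\<And>a b. f (a + b) = f a + f b" and zero: "f 0 = 0"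
    and mult: "\<And>a b. f (a * b) = f a * f b"
  shows "Poly_Mapping.map f (p * q) =
    Poly_Mapping.map f p * (Poly_Mapping.map f q :: ('m::monoid_add \<Rightarrow>\<^sub>0 'a))"
proof (induction p rule: poly_mapping_induct)
  case (single m a)
  show ?case
    by (induction q rule: poly_mapping_induct)
      (simp_all add: mult_single map_single zero mult poly_map_add[OF add zero] distrib_left)
qed (simp add: poly_map_add[OF add zero] distrib_right)

definition tau_grade :: "'k::kdv_scalars tau_ring \<Rightarrow> 'k tau_ring" where
  "tau_grade = Poly_Mapping.map grade"

lemma lookup_tau_grade: "Poly_Mapping.lookup (tau_grade p) m = grade (Poly_Mapping.lookup p m)"
  by (simp add: tau_grade_def lookup_map_zero grade_0)

lemma tau_grade_add: "tau_grade (p + q) = tau_grade p + tau_grade q"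
  unfolding tau_grade_def by (rule poly_map_add) (simp_all add: grade_add grade_0)

lemma tau_grade_mult: "tau_grade (p * q) = tau_grade p * tau_grade q"
  unfolding tau_grade_def by (rule poly_map_mult) (simp_all add: grade_add grade_0 grade_mult)

lemma tau_grade_emb: "tau_grade (emb a) = emb (grade a)"
  by (simp add: tau_grade_def emb_def map_single grade_0)

lemma tau_grade_f_var: "tau_grade (f_var k) = f_var k"
  by (simp add: tau_grade_def f_var_def map_single grade_0 grade_1)

lemma emb_add: "emb (a + b) = emb a + emb b"
  and emb_mult: "emb (a * b) = emb a * emb b"
  and emb_0: "emb 0 = 0" and emb_1: "emb 1 = 1"
  by (simp_all add: emb_def single_add mult_single)

lemma emb_uminus: "emb (- a) = - emb a"
  using emb_add by (rule additive_uminus)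

lemma tau_ring_induct [case_names emb f_var add mult]:
  fixes p :: "'k::kdv_scalars tau_ring"
  assumes "\<And>a. P (emb a)" "\<And>k. P (f_var k)"
    and "\<And>p q. P p \<Longrightarrow> P q \<Longrightarrow> P (p + q)"
    and "\<And>p q. P p \<Longrightarrow> P q \<Longrightarrow> P (p * q)"
  shows "P p"
  by (rule poly_var_induct) (simp_all only: assms flip: emb_def f_var_def)

interpretation tau: graded_ring tau_parity "tau_grade :: 'k::kdv_scalars tau_ring \<Rightarrow> 'k tau_ring"
proof
  show par: "p \<in> tau_parity q \<longleftrightarrow> tau_grade p = (if q then - p else p)" for p :: "'k tau_ring" and q
    by (auto simp: tau_parity_def parity_iff poly_mapping_eq_iff fun_eq_iff lookup_tau_grade)
  fix p :: "'k tau_ring"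
  let ?h = "emb (scal (of_real (1/2))) :: 'k tau_ring"
  have half: "?h * (p + p) = p"
  proof -
    have "?h + ?h = emb 1"
      by (simp add: scal_1 flip: emb_add scal_add of_real_add)
    then show ?thesis
      by (simp only: distrib_left emb_1 mult_1 flip: distrib_right)
  qed
  have grade_grade: "tau_grade (tau_grade p) = p"
    by (rule poly_mapping_eqI) (simp add: lookup_tau_grade grade_grade)
  show "\<exists>b\<in>tau_parity False. \<exists>c\<in>tau_parity True. p = b + c"
  proof (intro bexI)
    have "?h * (p + tau_grade p) + ?h * (p - tau_grade p) = ?h * (p + p)"
      by (simp add: algebra_simps)
    then show "p = ?h * (p + tau_grade p) + ?h * (p - tau_grade p)"
      by (simp only: half)
    show "?h * (p + tau_grade p) \<in> tau_parity False" "?h * (p - tau_grade p) \<in> tau_parity True"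
      by (simp_all add: par tau_grade_mult tau_grade_add additive_diff[OF tau_grade_add]
          tau_grade_emb grade_scal grade_grade algebra_simps)
  qed
qed (rule tau_grade_add)

text \<open>The one-point functions are free central variables; that \<open>V k\<close> is
  homogeneous of parity \<open>q\<close> gives the commutation rule required of a
  \<open>poly_derivation\<close>.\<close>

lemma ex_tau_extension:
  fixes D :: "'k::kdv_scalars sdiff \<Rightarrow> 'k sdiff"
  assumes D: "super_derivation parity scal q D" and V: "\<And>k. V k \<in> parity q"
  shows "\<exists>E. super_derivation tau_parity tau_scal q E \<and> (\<forall>a. E (emb a) = emb (D a)) \<and>
    (\<forall>k. E (f_var k) = emb (V k))"
proof -
  define \<alpha> :: "'k sdiff \<Rightarrow> 'k sdiff" where "\<alpha> a = (if q then grade a else a)" for a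
  define s :: "'k tau_ring" where "s = (if q then - 1 else 1)"
  have V_commute: "V k * a = \<alpha> a * V k" for k a
    using V[of k] even_commute[of "V k" a] odd_supercommute[of "V k" a]
    by (auto simp: parity_iff \<alpha>_def)
  interpret poly_derivation D \<alpha> "\<lambda>k. emb (V k)"
    by unfold_locales
      (simp_all add: sdiff.der_add[OF D] sdiff.der_mult[OF D] \<alpha>_def grade_add grade_mult grade_1
        V_commute flip: emb_def emb_mult)
  let ?E = "poly_der D \<alpha> (\<lambda>k. emb (V k))"
  have E_emb: "?E (emb a) = emb (D a)" for a
    by (simp only: emb_def[of a] emb_def[of "D a"] poly_der_const)
  have E_f: "?E (f_var k) = emb (V k)" for k
    by (simp only: f_var_def poly_der_var)
  have twist: "Poly_Mapping.map \<alpha> p = (if q then tau_grade p else p)" for p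
    by (rule poly_mapping_eqI) (simp add: lookup_map_zero \<alpha>_def grade_0 lookup_tau_grade)
  have s_commute: "x * (s * y) = s * (x * y)" for x y
    by (simp add: s_def)
  have grade_V: "emb (grade (V k)) = s * emb (V k)" for k
    using V[of k] by (simp add: parity_iff s_def emb_uminus)
  have grade_D: "emb (grade (D a)) = s * emb (D (grade a))" for a
    by (simp add: sdiff.der_gr[OF D] s_def emb_uminus)
  have grade_E: "tau_grade (?E p) = s * ?E (tau_grade p)" for p
  proof (induction p rule: tau_ring_induct)
    case (mult p p')
    have "tau_grade (Poly_Mapping.map \<alpha> p) = Poly_Mapping.map \<alpha> (tau_grade p)" for p
      by (simp add: twist)
    with mult show ?case
      by (simp add: poly_der_mult tau_grade_mult tau_grade_add distrib_left mult.assoc s_commute)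
  qed (simp_all add: E_emb E_f tau_grade_emb tau_grade_f_var grade_V grade_D
      poly_der_add tau_grade_add distrib_left)
  have "super_derivation tau_parity tau_scal q ?E"
  proof (rule tau.super_derivationI)
    show "tau_grade (?E p) = (if q then - 1 else 1) * ?E (tau_grade p)" for p
      using grade_E by (simp only: s_def)
  qed (simp_all only: poly_der_add poly_der_mult twist tau_scal_def E_emb sdiff.der_scal[OF D] emb_0)
  with E_emb E_f show ?thesis by blast
qed

lemma tau_super_comm_zero:
  fixes D E :: "'k::kdv_scalars tau_ring \<Rightarrow> 'k tau_ring"
  assumes D: "super_derivation tau_parity tau_scal q D" and E: "super_derivation tau_parity tau_scal q' E"
    and emb: "\<And>a. tau.super_comm q q' D E (emb a) = 0"
    and f_var: "\<And>k. tau.super_comm q q' D E (f_var k) = 0"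
  shows "tau.super_comm q q' D E p = 0"
  by (induction p rule: tau_ring_induct)
    (simp_all add: emb f_var tau.super_comm_add[OF D E] tau.super_comm_mult[OF D E])

context
  fixes R :: "nat \<Rightarrow> 'k::kdv_scalars sdiff" and t \<tau> \<Omega> \<Phi>
  assumes R: "lenard R" and flows: "super_kdv_flows R t \<tau>"
    and \<Omega>: "two_point R t \<Omega>" and \<Phi>: "\<And>k n. super_two_point R \<tau> k n (\<Phi> k n)"
begin

lemma dx_\<Omega>: "dx (\<Omega> k n) = t n (R (Suc k))" and dx_\<Phi>: "dx (\<Phi> k n) = \<tau> n (R (Suc k))"
  using \<Omega> \<Phi> by (simp_all add: two_point_def super_two_point_def)

lemma ex_super_tau_cover: "\<exists>X T \<Theta>. super_tau_cover R t \<tau> \<Omega> \<Phi> X T \<Theta>"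
proof -
  have "super_derivation parity scal False dx"
    by (rule sdiff.super_derivationI) (simp_all add: dx_add dx_scal dx_mult grade_dx)
  moreover have "R (Suc k) \<in> parity False" for k
    using R upolys0_grade by (auto simp: lenard_def parity_iff)
  ultimately obtain X where X: "super_derivation tau_parity tau_scal False X"
    "\<And>a. X (emb a) = emb (dx a)" "\<And>k. X (f_var k) = emb (R (Suc k))"
    using ex_tau_extension[of False dx "\<lambda>k. R (Suc k)"] by blast
  have "\<Omega> k n \<in> parity False" for k n
    using \<Omega> upolys0_grade by (auto simp: two_point_def parity_iff)
  then have "\<exists>E. super_derivation tau_parity tau_scal False E \<and> (\<forall>a. E (emb a) = emb (t n a)) \<and>
    (\<forall>k. E (f_var k) = emb (\<Omega> k n))" for n
    by (rule ex_tau_extension[OF der_t[OF R flows]])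
  then obtain T where T: "\<And>n. super_derivation tau_parity tau_scal False (T n)"
    "\<And>n a. T n (emb a) = emb (t n a)" "\<And>n k. T n (f_var k) = emb (\<Omega> k n)"
    by metis
  have "\<Phi> k n \<in> parity True" for k n
    using \<Phi> by (simp add: super_two_point_def)
  then have "\<exists>E. super_derivation tau_parity tau_scal True E \<and> (\<forall>a. E (emb a) = emb (\<tau> n a)) \<and>
    (\<forall>k. E (f_var k) = emb (\<Phi> k n))" for n
    by (rule ex_tau_extension[OF der_\<tau>[OF R flows]])
  then obtain \<Theta> where \<Theta>: "\<And>n. super_derivation tau_parity tau_scal True (\<Theta> n)"
    "\<And>n a. \<Theta> n (emb a) = emb (\<tau> n a)" "\<And>n k. \<Theta> n (f_var k) = emb (\<Phi> k n)"
    by metis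
  \<comment> \<open>On \<open>f_var k\<close> this is the defining equation
    \<open>dx_\<Omega>\<close>; the other generators lie in the differential ring.\<close>
  have "T n (X p) = X (T n p)" for n p
    using tau_super_comm_zero[OF T(1) X(1), of n p]
    by (simp add: tau.super_comm_def T X t_dx[OF R flows] dx_\<Omega>)
  moreover have "\<Theta> n (X p) = X (\<Theta> n p)" for n p
    using tau_super_comm_zero[OF \<Theta>(1) X(1), of n p]
    by (simp add: tau.super_comm_def \<Theta> X \<tau>_dx[OF R flows] dx_\<Phi>)
  ultimately have "super_tau_cover R t \<tau> \<Omega> \<Phi> X T \<Theta>"
    by (simp add: super_tau_cover_def X T \<Theta>)
  then show ?thesis by blast
qed

text \<open>The commutators are derivations, so generators suffice. On the differential ring the
  flows commute already; on the one-point functions two elements of that ring are compared through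
  their x-derivatives.\<close>

lemma super_tau_cover_commute:
  assumes cover: "super_tau_cover R t \<tau> \<Omega> \<Phi> X T \<Theta>"
  shows "mutually_commute T \<Theta>"
proof -
  have T: "super_derivation tau_parity tau_scal False (T n)"
    "T n (emb a) = emb (t n a)" "T n (f_var k) = emb (\<Omega> k n)"
    and \<Theta>: "super_derivation tau_parity tau_scal True (\<Theta> n)"
    "\<Theta> n (emb a) = emb (\<tau> n a)" "\<Theta> n (f_var k) = emb (\<Phi> k n)" for n k a
    using cover by (simp_all add: super_tau_cover_def)
  have tt: "t m (t n a) = t n (t m a)" and t\<tau>: "t m (\<tau> n a) = \<tau> n (t m a)"
    and \<tau>\<tau>: "\<tau> m (\<tau> n a) = - \<tau> n (\<tau> m a)" for m n a
    using flows_mutually_commute[OF R flows] unfolding mutually_commute_def by blast+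
  note dx = t_dx[OF R flows, symmetric] \<tau>_dx[OF R flows, symmetric]
  note aug = aug_t[OF R flows] aug_\<tau>[OF R flows]
  \<comment> \<open>The x-derivatives are second flow derivatives of \<open>R (Suc k)\<close>, and
    values of flows have no constant term. The next two facts follow in the same way.\<close>
  have \<Omega>\<Omega>: "t m (\<Omega> k n) = t n (\<Omega> k m)" for m n k
    by (rule dx_eqI) (simp_all add: aug dx dx_\<Omega> tt[of m])
  have \<Omega>\<Phi>: "t m (\<Phi> k n) = \<tau> n (\<Omega> k m)" for m n k
    by (rule dx_eqI) (simp_all add: aug dx dx_\<Omega> dx_\<Phi> t\<tau>)
  have \<Phi>\<Phi>: "\<tau> m (\<Phi> k n) = - \<tau> n (\<Phi> k m)" for m n k
    by (rule dx_eqI) (simp_all add: aug aug_uminus dx_uminus dx dx_\<Phi> \<tau>\<tau>[of m])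
  have "tau.super_comm False False (T m) (T n) p = 0" for m n p
    by (rule tau_super_comm_zero[OF T(1) T(1)])
      (simp_all add: tau.super_comm_def T tt[of m] \<Omega>\<Omega>[of m])
  moreover have "tau.super_comm False True (T m) (\<Theta> n) p = 0" for m n p
    by (rule tau_super_comm_zero[OF T(1) \<Theta>(1)])
      (simp_all add: tau.super_comm_def T \<Theta> t\<tau> \<Omega>\<Phi>)
  moreover have "tau.super_comm True True (\<Theta> m) (\<Theta> n) p = 0" for m n p
    by (rule tau_super_comm_zero[OF \<Theta>(1) \<Theta>(1)])
      (simp_all add: tau.super_comm_def \<Theta> \<tau>\<tau>[of m] \<Phi>\<Phi>[of m] emb_uminus)
  ultimately show ?thesis
    by (simp add: mutually_commute_def tau.super_comm_def eq_neg_iff_add_eq_0)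
qed

end

theorem theorem5p10:
  fixes R :: "nat \<Rightarrow> 'k::kdv_scalars sdiff"
  assumes "lenard R"
  shows "(\<exists>t \<tau>. super_kdv_flows R t \<tau>) \<and>
    (\<forall>t \<tau>. super_kdv_flows R t \<tau> \<longrightarrow>
       (\<forall>k n. \<exists>\<phi>. super_two_point R \<tau> k n \<phi>) \<and>
       (\<forall>\<Omega> \<Phi>. two_point R t \<Omega> \<and> (\<forall>k n. super_two_point R \<tau> k n (\<Phi> k n)) \<longrightarrow>
          (\<exists>X T \<Theta>. super_tau_cover R t \<tau> \<Omega> \<Phi> X T \<Theta>) \<and>
          (\<forall>X T \<Theta>. super_tau_cover R t \<tau> \<Omega> \<Phi> X T \<Theta> \<longrightarrow> mutually_commute T \<Theta>)))"
  using ex_super_kdv_flows[OF assms] ex_super_two_point[OF assms] ex_super_tau_cover[OF assms]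
    super_tau_cover_commute[OF assms] by blast

end
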